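(* There is an absolute constant $C$ such that the following holds for all positive integers $d_1,d_2,n,r$ and all $\alpha,\sigma>0$. Let $A_1,\dots,A_n\in\mathbb{R}^{d_1\times d_2}$ be independent copies of a random matrix with i.i.d. $\mathcal{N}(0,1)$ entries, and let $\eta_1,\dots,\eta_n$ be i.i.d. $\mathcal{N}(0,\sigma^2)$, independent of $(A_k)$. If $n\ge r(d_1+d_2)\log^6(d_1d_2)$, then with probability at least $1-(d_1+d_2)^{-1}$: for all $M_0\in\mathbb{R}^{d_1\times d_2}$ satisfying $\|M_0\|_{\mathrm F}\le\alpha$ and $\|M_0\|_*\le\sqrt r\,\alpha$, the estimate $\Phi$, i.e. a minimizer of $\sum_{k=1}^n(y_k-\mathrm{tr}(A_k^\top M))^2$ over $M\in\mathbb{R}^{d_1\times d_2}$ subject to $\max(\|M\|_{\mathrm F},\|M\|_*/\sqrt r)\le\alpha$, formed from $y_k=\mathrm{tr}(A_k^\top M_0)+\eta_k$, $k=1,\dots,n$, satisfies $$\|\Phi-M_0\|_{\mathrm F}^2\le C\,\alpha^2\max\left(1,\frac{\sigma\sqrt{\log(d_1+d_2)}}{\alpha}\right)\cdot\sqrt{\frac{r(d_1+d_2)\log^6(d_1d_2)}{n}}.$$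
   Context: $\|\cdot\|_{\mathrm F}$ is the Frobenius norm and $\|\cdot\|_*$ is the nuclear norm (sum of singular values). The probability is over $(A_k)$ and $(\eta_k)$, and the event is common to all such $M_0$.
   Formalization: The case d_1 = d_2 = 1 is excluded (d_1 d_2 ≥ 2 is assumed), because there log(d_1 d_2) = 0 makes the right-hand side 0, while for M_0 = 0 the estimate Φ is almost surely nonzero, so the claim is false. *)

theory Defs
  imports "HOL-Probability.Probability" "Jordan_Normal_Form.Char_Poly"
begin

text \<open>
  Matrices are those of \<open>Jordan_Normal_Form\<close>, whose dimensions are values rather than types, so
  that a constant can be quantified outside of the dimensions.
\<close>

definition mat_trace :: "real mat \<Rightarrow> real" where
  "mat_trace A = (\<Sum>i<dim_row A. A $$ (i, i))"

definition frobenius_norm :: "real mat \<Rightarrow> real" where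
  "frobenius_norm A = sqrt (\<Sum>i<dim_row A. \<Sum>j<dim_col A. (A $$ (i, j))\<^sup>2)"

text \<open>
  The square roots of the eigenvalues of the Gram matrix, with algebraic multiplicity. There are
  \<open>dim_col A\<close> of them; if \<open>dim_col A > dim_row A\<close>, the superfluous ones are \<open>0\<close>.
\<close>
definition singular_values :: "real mat \<Rightarrow> real multiset" where
  "singular_values A = image_mset sqrt (proots (char_poly (transpose_mat A * A)))"

definition nuclear_norm :: "real mat \<Rightarrow> real" where
  "nuclear_norm A = (\<Sum>s\<in>#singular_values A. s)"

definition feasible :: "nat \<Rightarrow> nat \<Rightarrow> nat \<Rightarrow> real \<Rightarrow> real mat \<Rightarrow> bool" where
  "feasible d1 d2 r \<alpha> M \<longleftrightarrow>
     M \<in> carrier_mat d1 d2 \<and> max (frobenius_norm M) (nuclear_norm M / sqrt (real r)) \<le> \<alpha>"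

definition square_loss :: "nat \<Rightarrow> (nat \<Rightarrow> real mat) \<Rightarrow> (nat \<Rightarrow> real) \<Rightarrow> real mat \<Rightarrow> real" where
  "square_loss n A y M = (\<Sum>k<n. (y k - mat_trace (transpose_mat (A k) * M))\<^sup>2)"

definition is_estimate ::
    "nat \<Rightarrow> nat \<Rightarrow> nat \<Rightarrow> nat \<Rightarrow> real \<Rightarrow> (nat \<Rightarrow> real mat) \<Rightarrow> (nat \<Rightarrow> real) \<Rightarrow> real mat \<Rightarrow> bool" where
  "is_estimate d1 d2 n r \<alpha> A y \<Phi> \<longleftrightarrow> is_arg_min (square_loss n A y) (feasible d1 d2 r \<alpha>) \<Phi>"

text \<open>The second parameter of \<open>normal_density\<close> is the standard deviation, not the variance.\<close>
definition centered_normal :: "real \<Rightarrow> real measure" where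
  "centered_normal \<sigma> = density lborel (\<lambda>x. ennreal (normal_density 0 \<sigma> x))"

text \<open>
  The law of the entries of a \<open>d1 \<times> d2\<close> matrix, as a function on the index pairs; the matrix itself
  is \<open>Matrix.mat d1 d2 g\<close>.
\<close>
definition gaussian_entries :: "nat \<Rightarrow> nat \<Rightarrow> (nat \<times> nat \<Rightarrow> real) measure" where
  "gaussian_entries d1 d2 = (\<Pi>\<^sub>M p\<in>{..<d1} \<times> {..<d2}. centered_normal 1)"

text \<open>
  The joint law of the data \<open>((A\<^sub>k)\<^sub>k, (\<eta>\<^sub>k)\<^sub>k)\<close>. Taking this law itself as the probability space
  keeps constants independent of any choice of sample space; \<open>distr_eq_data_law\<close> below shows that
  every realization of the random data on an arbitrary probability space is distributed according
  to it.
\<close>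
definition data_law ::
    "nat \<Rightarrow> nat \<Rightarrow> nat \<Rightarrow> real \<Rightarrow> ((nat \<Rightarrow> nat \<times> nat \<Rightarrow> real) \<times> (nat \<Rightarrow> real)) measure" where
  "data_law d1 d2 n \<sigma> =
     (\<Pi>\<^sub>M k\<in>{..<n}. gaussian_entries d1 d2) \<Otimes>\<^sub>M (\<Pi>\<^sub>M k\<in>{..<n}. centered_normal \<sigma>)"

lemma sets_centered_normal [measurable_cong]: "sets (centered_normal \<sigma>) = sets borel"
  by (simp add: centered_normal_def)

lemma sets_gaussian_entries [measurable_cong]:
  "sets (gaussian_entries d1 d2) = sets (\<Pi>\<^sub>M p\<in>{..<d1} \<times> {..<d2}. borel)"
  unfolding gaussian_entries_def by (intro sets_PiM_cong) (auto simp: sets_centered_normal)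

lemma prob_space_centered_normal: "0 < \<sigma> \<Longrightarrow> prob_space (centered_normal \<sigma>)"
  unfolding centered_normal_def by (rule prob_space_normal_density)

lemma prob_space_data_law:
  assumes "0 < \<sigma>"
  shows "prob_space (data_law d1 d2 n \<sigma>)"
  unfolding data_law_def gaussian_entries_def
  by (intro prob_space_pair prob_space_PiM prob_space_centered_normal assms) auto

lemma distr_distributed_centered_normal:
  assumes "distributed P lborel X (\<lambda>x. ennreal (normal_density 0 \<sigma> x))"
  shows "distr P borel X = centered_normal \<sigma>"
proof -
  have "distr P borel X = distr P lborel X" by (rule distr_cong) auto
  also have "\<dots> = centered_normal \<sigma>"
    using distributed_distr_eq_density[OF assms] by (simp add: centered_normal_def)
  finally show ?thesis .
qed

lemma (in prob_space) distr_pair_indep_set: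
  assumes X: "random_variable S X" and Y: "random_variable T Y"
    and indep: "indep_set {X -` B \<inter> space M | B. B \<in> sets S} {Y -` B \<inter> space M | B. B \<in> sets T}"
  shows "distr M (S \<Otimes>\<^sub>M T) (\<lambda>\<omega>. (X \<omega>, Y \<omega>)) = distr M S X \<Otimes>\<^sub>M distr M T Y"
proof -
  interpret X: prob_space "distr M S X" by (rule prob_space_distr[OF X])
  interpret Y: prob_space "distr M T Y" by (rule prob_space_distr[OF Y])
  have XY: "random_variable (S \<Otimes>\<^sub>M T) (\<lambda>\<omega>. (X \<omega>, Y \<omega>))"
    using X Y by (rule measurable_Pair)
  show ?thesis
  proof (rule pair_measure_eqI[symmetric])
    fix B1 B2 assume B: "B1 \<in> sets (distr M S X)" "B2 \<in> sets (distr M T Y)"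
    have "prob ((X -` B1 \<inter> space M) \<inter> (Y -` B2 \<inter> space M)) =
        prob (X -` B1 \<inter> space M) * prob (Y -` B2 \<inter> space M)"
      using B by (intro indep_setD[OF indep]) auto
    moreover have "(X -` B1 \<inter> space M) \<inter> (Y -` B2 \<inter> space M) =
        (\<lambda>\<omega>. (X \<omega>, Y \<omega>)) -` (B1 \<times> B2) \<inter> space M"
      by auto
    ultimately show "emeasure (distr M S X) B1 * emeasure (distr M T Y) B2 =
        emeasure (distr M (S \<Otimes>\<^sub>M T) (\<lambda>\<omega>. (X \<omega>, Y \<omega>))) (B1 \<times> B2)"
      using B X Y XY by (simp add: emeasure_distr emeasure_eq_measure ennreal_mult)
  qed (simp_all add: X.sigma_finite_measure_axioms Y.sigma_finite_measure_axioms
         cong: sets_pair_measure_cong)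
qed

lemma (in prob_space) distr_eq_data_law:
  fixes d1 d2 n :: nat and X :: "nat \<Rightarrow> nat \<times> nat \<Rightarrow> 'a \<Rightarrow> real"
    and \<eta> :: "nat \<Rightarrow> 'a \<Rightarrow> real"
  defines "I \<equiv> {..<d1} \<times> {..<d2}"
  defines "A \<equiv> \<lambda>k \<omega>. \<lambda>p\<in>I. X k p \<omega>"
  assumes dims: "0 < d1" "0 < d2" "0 < n"
    and entries: "\<And>k. k < n \<Longrightarrow> indep_vars (\<lambda>_. borel) (X k) I"
    and entry: "\<And>k p. k < n \<Longrightarrow> p \<in> I \<Longrightarrow>
      distributed M lborel (X k p) (\<lambda>x. ennreal (normal_density 0 1 x))"
    and matrices: "indep_vars (\<lambda>_. \<Pi>\<^sub>M p\<in>I. borel) A {..<n}"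
    and noises: "indep_vars (\<lambda>_. borel) \<eta> {..<n}"
    and noise: "\<And>k. k < n \<Longrightarrow>
      distributed M lborel (\<eta> k) (\<lambda>x. ennreal (normal_density 0 \<sigma> x))"
    and indep: "indep_set
      {(\<lambda>\<omega>. \<lambda>k\<in>{..<n}. A k \<omega>) -` S \<inter> space M | S. S \<in> sets (\<Pi>\<^sub>M k\<in>{..<n}. \<Pi>\<^sub>M p\<in>I. borel)}
      {(\<lambda>\<omega>. \<lambda>k\<in>{..<n}. \<eta> k \<omega>) -` T \<inter> space M | T. T \<in> sets (\<Pi>\<^sub>M k\<in>{..<n}. borel)}"
  shows "distr M (data_law d1 d2 n \<sigma>)
      (\<lambda>\<omega>. (\<lambda>k\<in>{..<n}. A k \<omega>, \<lambda>k\<in>{..<n}. \<eta> k \<omega>)) = data_law d1 d2 n \<sigma>"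
proof -
  have I: "I \<noteq> {}" and N: "{..<n} \<noteq> {}"
    using dims by (auto simp: I_def lessThan_empty_iff)
  have "distr M (\<Pi>\<^sub>M p\<in>I. borel) (A k) = gaussian_entries d1 d2" if k: "k < n" for k
  proof -
    have rv: "random_variable borel (X k p)" if "p \<in> I" for p
      using distributed_measurable[OF entry[OF k that]] by simp
    have "distr M (\<Pi>\<^sub>M p\<in>I. borel) (A k) = (\<Pi>\<^sub>M p\<in>I. distr M borel (X k p))"
      using indep_vars_iff_distr_eq_PiM'[OF I rv] entries[OF k] by (simp add: A_def)
    also have "\<dots> = gaussian_entries d1 d2"
      unfolding gaussian_entries_def I_def[symmetric]
      by (intro PiM_cong refl distr_distributed_centered_normal entry k)
    finally show ?thesis .
  qed
  moreover have "random_variable (\<Pi>\<^sub>M p\<in>I. borel) (A k)" if "k < n" for k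
    using matrices that by (auto simp: indep_vars_def)
  ultimately have 1: "distr M (\<Pi>\<^sub>M k\<in>{..<n}. \<Pi>\<^sub>M p\<in>I. borel) (\<lambda>\<omega>. \<lambda>k\<in>{..<n}. A k \<omega>) =
      (\<Pi>\<^sub>M k\<in>{..<n}. gaussian_entries d1 d2)"
    using indep_vars_iff_distr_eq_PiM'[OF N, where M' = "\<lambda>_. \<Pi>\<^sub>M p\<in>I. borel" and X = A] matrices
    by (auto intro!: PiM_cong)
  have rv: "random_variable borel (\<eta> k)" if "k \<in> {..<n}" for k
    using distributed_measurable[OF noise] that by simp
  have "distr M (\<Pi>\<^sub>M k\<in>{..<n}. borel) (\<lambda>\<omega>. \<lambda>k\<in>{..<n}. \<eta> k \<omega>) =
      (\<Pi>\<^sub>M k\<in>{..<n}. distr M borel (\<eta> k))"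
    using indep_vars_iff_distr_eq_PiM'[OF N rv] noises by simp
  also have "\<dots> = (\<Pi>\<^sub>M k\<in>{..<n}. centered_normal \<sigma>)"
    by (intro PiM_cong refl distr_distributed_centered_normal noise) simp
  finally have 2: "distr M (\<Pi>\<^sub>M k\<in>{..<n}. borel) (\<lambda>\<omega>. \<lambda>k\<in>{..<n}. \<eta> k \<omega>) =
      (\<Pi>\<^sub>M k\<in>{..<n}. centered_normal \<sigma>)" .
  have rvs: "random_variable (\<Pi>\<^sub>M k\<in>{..<n}. \<Pi>\<^sub>M p\<in>I. borel) (\<lambda>\<omega>. \<lambda>k\<in>{..<n}. A k \<omega>)"
      "random_variable (\<Pi>\<^sub>M k\<in>{..<n}. borel) (\<lambda>\<omega>. \<lambda>k\<in>{..<n}. \<eta> k \<omega>)"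
    using matrices noises by (auto intro!: measurable_restrict simp: indep_vars_def)
  have "sets (data_law d1 d2 n \<sigma>) =
      sets ((\<Pi>\<^sub>M k\<in>{..<n}. \<Pi>\<^sub>M p\<in>I. borel) \<Otimes>\<^sub>M (\<Pi>\<^sub>M k\<in>{..<n}. borel))"
    unfolding data_law_def I_def
    by (intro sets_pair_measure_cong sets_PiM_cong refl sets_gaussian_entries sets_centered_normal)
  then have "distr M (data_law d1 d2 n \<sigma>) (\<lambda>\<omega>. (\<lambda>k\<in>{..<n}. A k \<omega>, \<lambda>k\<in>{..<n}. \<eta> k \<omega>)) =
      distr M ((\<Pi>\<^sub>M k\<in>{..<n}. \<Pi>\<^sub>M p\<in>I. borel) \<Otimes>\<^sub>M (\<Pi>\<^sub>M k\<in>{..<n}. borel))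
        (\<lambda>\<omega>. (\<lambda>k\<in>{..<n}. A k \<omega>, \<lambda>k\<in>{..<n}. \<eta> k \<omega>))"
    by (intro distr_cong) auto
  also have "\<dots> = data_law d1 d2 n \<sigma>"
    using distr_pair_indep_set[OF _ _ indep] rvs by (simp add: 1 2 data_law_def)
  finally show ?thesis .
qed

definition sensing_matrix ::
    "nat \<Rightarrow> nat \<Rightarrow> (nat \<Rightarrow> nat \<times> nat \<Rightarrow> real) \<times> (nat \<Rightarrow> real) \<Rightarrow> nat \<Rightarrow> real mat" where
  "sensing_matrix d1 d2 \<omega> k = Matrix.mat d1 d2 (fst \<omega> k)"

definition observation ::
    "nat \<Rightarrow> nat \<Rightarrow> real mat \<Rightarrow> (nat \<Rightarrow> nat \<times> nat \<Rightarrow> real) \<times> (nat \<Rightarrow> real) \<Rightarrow> nat \<Rightarrow> real" where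
  "observation d1 d2 M0 \<omega> k =
     mat_trace (transpose_mat (sensing_matrix d1 d2 \<omega> k) * M0) + snd \<omega> k"

end

theory Submission
  imports Defs
begin

text \<open>
  Write \<open>\<langle>A, M\<rangle>\<close> for \<open>tr (A\<^sup>T M)\<close>, \<open>D\<close> for \<open>d1 + d2\<close> and \<open>h\<close> for \<open>\<Phi> - M0\<close>. The matrix \<open>M0\<close> competes in the
  minimization that defines \<open>\<Phi>\<close>, so \<open>\<Sum>\<^sub>k \<langle>A\<^sub>k, h\<rangle>\<^sup>2 \<le> 2 \<Sum>\<^sub>k \<eta>\<^sub>k \<langle>A\<^sub>k, h\<rangle>\<close> (\<open>basic_inequality\<close>). Hence
  it suffices to find one event on which, for every \<open>h\<close> that can occur, both the gram error
  \<open>\<Sum>\<^sub>k \<langle>A\<^sub>k, h\<rangle>\<^sup>2 / n - \<parallel>h\<parallel>\<^sup>2\<close> and the noise term \<open>\<Sum>\<^sub>k \<eta>\<^sub>k \<langle>A\<^sub>k, h\<rangle> / n\<close> are small.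

  The possible \<open>h\<close> are governed by matrices of rank \<open>r\<close>. If \<open>\<parallel>M\<parallel>\<^sub>F \<le> \<alpha>\<close> and \<open>\<parallel>M\<parallel>\<^sub>* \<le> \<surd>r \<alpha>\<close>, then at most
  \<open>r\<close> singular values exceed \<open>\<alpha> / \<surd>r\<close>; sorting the others and cutting them into blocks of length
  \<open>r\<close>, the largest value of each block is at most the mean of the preceding block, so that \<open>M\<close> is
  a sum of matrices of rank at most \<open>r\<close> whose Frobenius norms add up to at most \<open>3 \<alpha>\<close>
  (\<open>factored_sum_of_norm_bounds\<close>). The gram error is bilinear and the noise term is linear, so
  both need to be bounded only for products \<open>W V\<^sup>T\<close> of matrices with \<open>r\<close> columns.

  For these a finite set of \<open>7 ^ (r D)\<close> matrices is enough (\<open>exists_norming_set\<close>). By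
  polarization, the two quantities at the points of that set are combinations of the deviations of
  \<open>\<Sum>\<^sub>k (\<langle>A\<^sub>k, x\<rangle> + t \<eta>\<^sub>k / \<sigma>)\<^sup>2\<close> from \<open>n (\<parallel>x\<parallel>\<^sup>2 + t\<^sup>2)\<close>. Each such sum is a multiple of a chi-square variable
  with \<open>n\<close> degrees of freedom, whose relative deviation exceeds \<open>\<delta> = 512 \<surd>(r D / n)\<close> with probability at most
  \<open>2 exp (- 8 r D)\<close> (\<open>deviation_tail\<close>), and a union bound over the finite set gives the event.
  On it, \<open>\<parallel>h\<parallel>\<^sup>2 \<le> \<delta> (576 \<alpha>\<^sup>2 + 48 \<sigma> \<alpha>)\<close>, which is of the required form because \<open>ln D \<ge> 1\<close> and
  \<open>(ln (d1 d2))\<^sup>3 \<ge> 8 / 27\<close>.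
\<close>

section \<open>Singular value decomposition\<close>

definition dot :: "nat \<Rightarrow> (nat \<Rightarrow> real) \<Rightarrow> (nat \<Rightarrow> real) \<Rightarrow> real" where
  "dot d x y = (\<Sum>i<d. x i * y i)"

definition mat_app :: "nat \<Rightarrow> (nat \<times> nat \<Rightarrow> real) \<Rightarrow> (nat \<Rightarrow> real) \<Rightarrow> nat \<Rightarrow> real" where
  "mat_app d M x = (\<lambda>i. \<Sum>j<d. M (i, j) * x j)"

definition orthonormal :: "nat \<Rightarrow> nat \<Rightarrow> (nat \<Rightarrow> nat \<Rightarrow> real) \<Rightarrow> bool" where
  "orthonormal d k v \<longleftrightarrow> (\<forall>i<k. \<forall>j<k. dot d (v i) (v j) = (if i = j then 1 else 0))"

lemma dot_commute: "dot d x y = dot d y x"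
  by (simp add: dot_def mult.commute)

lemma dot_add_right: "dot d x (\<lambda>i. a * y i + b * z i) = a * dot d x y + b * dot d x z"
  by (simp add: dot_def sum_distrib_left sum.distrib algebra_simps)

lemma dot_add_left: "dot d (\<lambda>i. a * y i + b * z i) x = a * dot d y x + b * dot d z x"
  using dot_add_right[of d x a y b z] by (simp add: dot_commute)

lemma mat_app_add:
  "mat_app d M (\<lambda>i. a * y i + b * z i) = (\<lambda>i. a * mat_app d M y i + b * mat_app d M z i)"
  by (simp add: mat_app_def sum_distrib_left sum.distrib algebra_simps)

lemma dot_self_nonneg: "0 \<le> dot d x x"
  by (simp add: dot_def sum_nonneg)

text \<open>
  The matrix \<open>E\<close> is the orthogonal projection onto the complement of the span of the \<open>v i\<close>, and its
  trace counts the missing dimensions. This takes the place of dimension theory: positive trace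
  yields a further vector, and vanishing trace forces completeness.
\<close>
lemma orthonormal_defect:
  assumes v: "orthonormal d k v"
  defines "E \<equiv> \<lambda>j l. (if j = l then 1 else 0) - (\<Sum>i<k. v i j * v i l)"
  shows "m < k \<Longrightarrow> j < d \<Longrightarrow> dot d (v m) (E j) = 0"
    and "j < d \<Longrightarrow> dot d (E j) (E j) = E j j"
    and "(\<Sum>j<d. E j j) = real d - real k"
proof -
  show *: "dot d (v m) (E j) = 0" if "m < k" "j < d" for m j
  proof -
    have "dot d (v m) (E j) =
        (\<Sum>l<d. v m l * (if j = l then 1 else 0)) - (\<Sum>l<d. \<Sum>i<k. v i j * (v m l * v i l))"
      by (simp add: dot_def E_def right_diff_distrib sum_subtractf sum_distrib_left
          algebra_simps)
    also have "(\<Sum>l<d. \<Sum>i<k. v i j * (v m l * v i l)) = (\<Sum>i<k. v i j * dot d (v m) (v i))"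
      by (subst sum.swap) (simp add: dot_def sum_distrib_left)
    also have "\<dots> = (\<Sum>i<k. if m = i then v i j else 0)"
      using v that by (intro sum.cong) (auto simp: orthonormal_def)
    also have "(\<Sum>l<d. v m l * (if j = l then 1 else 0)) = (\<Sum>l<d. if j = l then v m l else 0)"
      by (intro sum.cong) auto
    finally show ?thesis using that by simp
  qed
  show "dot d (E j) (E j) = E j j" if "j < d"
  proof -
    have "dot d (E j) (E j) =
        (\<Sum>l<d. if j = l then E j l else 0) - (\<Sum>l<d. \<Sum>i<k. v i j * (v i l * E j l))"
      unfolding dot_def sum_subtractf[symmetric]
    proof (rule sum.cong)
      fix l
      have "E j l * E j l = E j l * (if j = l then 1 else 0) - (\<Sum>i<k. E j l * (v i j * v i l))"
        by (simp add: E_def right_diff_distrib sum_distrib_left)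
      also have "(\<Sum>i<k. E j l * (v i j * v i l)) = (\<Sum>i<k. v i j * (v i l * E j l))"
        by (intro sum.cong) (auto simp only: mult_ac)
      also have "E j l * (if j = l then 1 else 0) = (if j = l then E j l else 0)"
        by simp
      finally show "E j l * E j l = (if j = l then E j l else 0) - (\<Sum>i<k. v i j * (v i l * E j l))" .
    qed simp
    also have "(\<Sum>l<d. \<Sum>i<k. v i j * (v i l * E j l)) = (\<Sum>i<k. v i j * dot d (v i) (E j))"
      by (subst sum.swap) (simp add: dot_def sum_distrib_left)
    also have "\<dots> = 0"
      using * that by simp
    finally show ?thesis using that by simp
  qed
  have "(\<Sum>j<d. E j j) = real d - (\<Sum>j<d. \<Sum>i<k. v i j * v i j)"
    by (simp add: E_def sum_subtractf)
  also have "(\<Sum>j<d. \<Sum>i<k. v i j * v i j) = (\<Sum>i<k. dot d (v i) (v i))"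
    by (subst sum.swap) (simp add: dot_def)
  also have "\<dots> = real k"
    using v by (simp add: orthonormal_def)
  finally show "(\<Sum>j<d. E j j) = real d - real k" .
qed

text \<open>
  The projection has positive trace, so some diagonal entry is positive, and the corresponding row
  can be normalized.
\<close>
lemma exists_unit_orthogonal:
  assumes v: "orthonormal d k v" and k: "k < d"
  shows "\<exists>x. dot d x x = 1 \<and> (\<forall>i<k. dot d (v i) x = 0)"
proof -
  define E where "E = (\<lambda>j l. (if j = l then 1 else 0) - (\<Sum>i<k. v i j * v i l))"
  have defect: "\<And>m j. m < k \<Longrightarrow> j < d \<Longrightarrow> dot d (v m) (E j) = 0"
    "\<And>j. j < d \<Longrightarrow> dot d (E j) (E j) = E j j" "(\<Sum>j<d. E j j) = real d - real k"
    unfolding E_def using orthonormal_defect[OF v] by blast+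
  have "\<exists>j<d. E j j > 0"
  proof (rule ccontr)
    assume "\<not> ?thesis"
    then have "(\<Sum>j<d. E j j) \<le> 0"
      by (intro sum_nonpos) force
    with defect(3) k show False by simp
  qed
  then obtain j where j: "j < d" "E j j > 0" by auto
  define c where "c = 1 / sqrt (E j j)"
  have "dot d (\<lambda>l. c * E j l) (\<lambda>l. c * E j l) = c\<^sup>2 * dot d (E j) (E j)"
    by (simp add: dot_def sum_distrib_left power2_eq_square algebra_simps)
  then have "dot d (\<lambda>l. c * E j l) (\<lambda>l. c * E j l) = 1"
    using defect(2) j by (simp add: c_def power_divide)
  moreover have "dot d (v i) (\<lambda>l. c * E j l) = 0" if "i < k" for i
    using defect(1)[OF that j(1)] by (simp add: dot_def sum_distrib_left[symmetric] algebra_simps)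
  ultimately show ?thesis by blast
qed

lemma orthonormal_complete:
  assumes v: "orthonormal d d v" and "j < d" "l < d"
  shows "(\<Sum>i<d. v i j * v i l) = (if j = l then 1 else 0)"
proof -
  define E where "E = (\<lambda>j l. (if j = l then 1 else 0) - (\<Sum>i<d. v i j * v i l))"
  have defect: "\<And>j. j < d \<Longrightarrow> dot d (E j) (E j) = E j j" "(\<Sum>j<d. E j j) = 0"
    unfolding E_def using orthonormal_defect(2,3)[OF v] by simp_all
  have "(\<Sum>j<d. dot d (E j) (E j)) = 0"
    using defect by simp
  then have "dot d (E j) (E j) = 0"
    using assms(2) by (subst (asm) sum_nonneg_eq_0_iff) (auto simp: dot_self_nonneg)
  then have "E j l * E j l = 0"
    using assms(3) unfolding dot_def by (subst (asm) sum_nonneg_eq_0_iff) auto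
  then show ?thesis by (simp add: E_def)
qed

text \<open>
  Vectors of length \<open>d\<close> are functions on all of \<open>nat\<close>. With the irrelevant coordinates set to \<open>0\<close>,
  the unit sphere becomes a closed subset of a product of compact intervals.
\<close>
lemma maximizer_exists:
  fixes v :: "nat \<Rightarrow> nat \<Rightarrow> real"
  assumes "\<exists>x. dot d x x = 1 \<and> (\<forall>i<k. dot d (v i) x = 0)"
  shows "\<exists>x. dot d x x = 1 \<and> (\<forall>i<k. dot d (v i) x = 0) \<and>
    (\<forall>y. dot d y y = 1 \<longrightarrow> (\<forall>i<k. dot d (v i) y = 0) \<longrightarrow>
      dot m (mat_app d M y) (mat_app d M y) \<le> dot m (mat_app d M x) (mat_app d M x))"
proof -
  define B :: "(nat \<Rightarrow> real) set" where
    "B = Pi\<^sub>E UNIV (\<lambda>i. if i < d then {-1..1} else {0})"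
  define S where "S = B \<inter> ({x. dot d x x = 1} \<inter> (\<Inter>i<k. {x. dot d (v i) x = 0}))"
  define f where "f = (\<lambda>x. dot m (mat_app d M x) (mat_app d M x))"
  define cut where "cut = (\<lambda>x i. if i < d then x i else (0::real))"
  have cont: "continuous_on UNIV (\<lambda>x. dot d (g x) (h x))"
    if "\<And>i. continuous_on UNIV (\<lambda>x. g x i)" "\<And>i. continuous_on UNIV (\<lambda>x. h x i)"
    for g h :: "(nat \<Rightarrow> real) \<Rightarrow> nat \<Rightarrow> real" and d
    unfolding dot_def by (intro continuous_intros that)
  have "compactin (product_topology (\<lambda>_. euclidean) UNIV) B"
    unfolding B_def by (subst compactin_PiE) auto
  then have "compact B"
    by (simp add: euclidean_product_topology compactin_euclidean_iff)
  moreover have "closed ({x. dot d x x = 1} \<inter> (\<Inter>i<k. {x. dot d (v i) x = 0}))"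
    by (intro closed_Int closed_INT ballI closed_Collect_eq cont continuous_intros
        continuous_on_product_coordinates)
  ultimately have S: "compact S"
    unfolding S_def by (rule compact_Int_closed)
  have cut: "cut x \<in> S" if "dot d x x = 1" "\<forall>i<k. dot d (v i) x = 0" for x
  proof -
    have "(x i)\<^sup>2 \<le> dot d x x" if "i < d" for i
      unfolding dot_def power2_eq_square[symmetric]
      by (rule member_le_sum[of i _ "\<lambda>i. (x i)\<^sup>2"]) (use that in auto)
    then have "\<bar>x i\<bar> \<le> 1" if "i < d" for i
      using that \<open>dot d x x = 1\<close> abs_le_square_iff[of "x i" 1] by auto
    then have "cut x \<in> B" unfolding B_def cut_def by (force simp: abs_le_iff)
    then show ?thesis using that by (auto simp: S_def dot_def cut_def)
  qed
  then have "S \<noteq> {}" using assms by blast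
  have "continuous_on S f"
    unfolding f_def mat_app_def
    by (rule continuous_on_subset[OF cont]) (auto intro!: continuous_intros)
  from continuous_attains_sup[OF S \<open>S \<noteq> {}\<close> this] obtain x where
    x: "x \<in> S" "\<And>y. y \<in> S \<Longrightarrow> f y \<le> f x" by blast
  have "f y \<le> f x" if "dot d y y = 1" "\<forall>i<k. dot d (v i) y = 0" for y
    using x(2)[OF cut[OF that]] by (simp add: f_def mat_app_def cut_def)
  with x(1) show ?thesis
    by (intro exI[of _ x]) (auto simp: S_def f_def)
qed

lemma linear_quadratic_nonpos_imp_zero:
  fixes a b :: real
  assumes "\<And>t. a * t + b * t\<^sup>2 \<le> 0"
  shows "a = 0"
proof (rule ccontr)
  assume "a \<noteq> 0"
  define q where "q = \<bar>b\<bar> + 1"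
  have q: "0 < q" "- q \<le> b" by (auto simp: q_def)
  define t where "t = a / (2 * q)"
  have "- q * t\<^sup>2 \<le> b * t\<^sup>2"
    using q by (intro mult_right_mono) auto
  moreover have "q * t\<^sup>2 = a * t / 2"
    using q by (simp add: t_def power2_eq_square)
  moreover have "a * t > 0"
    using \<open>a \<noteq> 0\<close> q by (auto simp: t_def zero_less_divide_iff zero_less_mult_iff)
  ultimately show False using assms[of t] by simp
qed

text \<open>
  The vectors are chosen greedily: \<open>v k\<close> maximizes \<open>\<parallel>M x\<parallel>\<close> among the unit vectors \<open>x\<close> that are
  orthogonal to its predecessors. The first-order condition at the maximizer says that \<open>M (v k)\<close> is
  orthogonal to \<open>M y\<close> for all \<open>y\<close> orthogonal to \<open>v 0, \<dots>, v k\<close>; in particular, the images of the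
  chosen vectors are orthogonal to each other.
\<close>
lemma exists_right_singular_vectors:
  assumes "k \<le> d"
  shows "\<exists>v. orthonormal d k v \<and> (\<forall>i<k. \<forall>y. (\<forall>j\<le>i. dot d (v j) y = 0) \<longrightarrow>
    dot m (mat_app d M (v i)) (mat_app d M y) = 0)"
  using assms
proof (induction k)
  case 0
  then show ?case by (simp add: orthonormal_def)
next
  case (Suc k)
  then obtain v where v: "orthonormal d k v" "\<And>i y. i < k \<Longrightarrow> (\<forall>j\<le>i. dot d (v j) y = 0) \<Longrightarrow>
    dot m (mat_app d M (v i)) (mat_app d M y) = 0" by auto
  obtain x where x: "dot d x x = 1" "\<And>i. i < k \<Longrightarrow> dot d (v i) x = 0"
    "\<And>y. dot d y y = 1 \<Longrightarrow> (\<forall>i<k. dot d (v i) y = 0) \<Longrightarrow>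
      dot m (mat_app d M y) (mat_app d M y) \<le> dot m (mat_app d M x) (mat_app d M x)"
    using maximizer_exists[OF exists_unit_orthogonal[OF v(1)], of m M] Suc.prems by auto
  define f where "f = (\<lambda>x. dot m (mat_app d M x) (mat_app d M x))"
  \<comment> \<open>Homogeneity extends maximality from unit vectors to all vectors.\<close>
  have homog: "f y \<le> f x * dot d y y" if "\<forall>i<k. dot d (v i) y = 0" "dot d y y > 0" for y
  proof -
    define c where "c = 1 / sqrt (dot d y y)"
    have "c * c = 1 / dot d y y" using that by (simp add: c_def)
    then have c2: "c * (c * z) = z / dot d y y" for z
      by (simp add: mult.assoc[symmetric])
    have "f (\<lambda>i. c * y i + 0 * y i) \<le> f x"
      unfolding f_def
      by (rule x(3); simp only: dot_add_left dot_add_right) (use that c2 in simp_all)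
    then have "f y / dot d y y \<le> f x"
      unfolding f_def mat_app_add dot_add_left dot_add_right by (simp add: c2)
    then show ?thesis
      using that by (simp add: divide_le_eq)
  qed
  have orth: "dot m (mat_app d M x) (mat_app d M y) = 0"
    if y: "\<forall>i<k. dot d (v i) y = 0" "dot d x y = 0" for y
  proof -
    have "2 * dot m (mat_app d M x) (mat_app d M y) * t + (f y - f x * dot d y y) * t\<^sup>2 \<le> 0" for t
    proof -
      define z where "z = (\<lambda>i. 1 * x i + t * y i)"
      have left: "dot d z u = dot d x u + t * dot d y u" for u
        using dot_add_left[of d 1 x t y u] by (simp add: z_def)
      have right: "dot d u z = dot d u x + t * dot d u y" for u
        using dot_add_right[of d u 1 x t y] by (simp add: z_def)
      have zz: "dot d z z = 1 + t\<^sup>2 * dot d y y"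
        using y(2) x(1) by (simp add: left right dot_commute[of d y x] power2_eq_square)
      have "f z \<le> f x * dot d z z"
      proof (rule homog)
        show "\<forall>i<k. dot d (v i) z = 0"
          using y(1) x(2) by (simp add: right)
        show "0 < dot d z z"
          unfolding zz using dot_self_nonneg[of d y] by (simp add: add_pos_nonneg)
      qed
      moreover have "f z = f x + 2 * t * dot m (mat_app d M x) (mat_app d M y) + t\<^sup>2 * f y"
      proof -
        define X Y where "X = mat_app d M x" and "Y = mat_app d M y"
        have "mat_app d M z = (\<lambda>i. 1 * X i + t * Y i)"
          unfolding z_def X_def Y_def by (rule mat_app_add)
        then have "f z = dot m X X + t * dot m X Y + t * (dot m Y X + t * dot m Y Y)"
          using dot_add_left[of m 1 X t Y "\<lambda>i. 1 * X i + t * Y i"]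
            dot_add_right[of m X 1 X t Y] dot_add_right[of m Y 1 X t Y]
          by (simp add: f_def)
        then show ?thesis
          unfolding f_def X_def[symmetric] Y_def[symmetric] dot_commute[of m Y X]
          by (simp add: power2_eq_square algebra_simps)
      qed
      ultimately show ?thesis unfolding zz by (simp add: algebra_simps)
    qed
    from linear_quadratic_nonpos_imp_zero[OF this] show ?thesis by simp
  qed
  define v' where "v' = v(k := x)"
  have "orthonormal d (Suc k) v'"
    using v(1) x(1,2) x(2)[unfolded dot_commute[of d _ x]]
    by (auto simp: orthonormal_def v'_def less_Suc_eq)
  moreover have "dot m (mat_app d M (v' i)) (mat_app d M y) = 0"
    if i: "i < Suc k" and y: "\<forall>j\<le>i. dot d (v' j) y = 0" for i y
  proof (cases "i < k")
    case True
    have "dot d (v j) y = 0" if "j \<le> i" for j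
      using y[rule_format, OF that] that True by (simp add: v'_def)
    then show ?thesis using v(2)[OF True, of y] True by (simp add: v'_def)
  next
    case False
    then have "i = k" using i by simp
    have "dot d (v j) y = 0" if "j < k" for j
      using y[rule_format, of j] that \<open>i = k\<close> by (simp add: v'_def)
    moreover have "dot d x y = 0"
      using y \<open>i = k\<close> by (auto simp: v'_def)
    ultimately show ?thesis using orth \<open>i = k\<close> by (simp add: v'_def)
  qed
  ultimately show ?case by blast
qed


text \<open>
  In the basis \<open>v\<close> of right singular vectors the Gram matrix of \<open>A\<close> is diagonal, which identifies
  the roots of its characteristic polynomial. The vectors \<open>w l\<close> are left singular vectors scaled
  by their singular values, so that vanishing singular values need no choice of a direction.
\<close>
lemma singular_value_decomposition:
  assumes A: "A \<in> carrier_mat m d"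
  shows "\<exists>w v. orthonormal d d v \<and>
    (\<forall>i<m. \<forall>j<d. A $$ (i, j) = (\<Sum>l<d. w l i * v l j)) \<and>
    (\<Sum>l<d. sqrt (dot m (w l) (w l))) = nuclear_norm A \<and>
    (\<Sum>l<d. dot m (w l) (w l)) = (frobenius_norm A)\<^sup>2"
proof -
  define M where "M = (\<lambda>p. A $$ p)"
  obtain v where v: "orthonormal d d v"
    and vM: "\<And>i y. i < d \<Longrightarrow> (\<forall>j\<le>i. dot d (v j) y = 0) \<Longrightarrow>
      dot m (mat_app d M (v i)) (mat_app d M y) = 0"
    using exists_right_singular_vectors[of d d m M] by auto
  define w where "w = (\<lambda>l. mat_app d M (v l))"
  define s where "s = (\<lambda>l. dot m (w l) (w l))"
  note complete = orthonormal_complete[OF v]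
  have w_lt: "dot m (w i) (w j) = 0" if "i < j" "j < d" for i j
    using vM[of i "v j"] v that by (auto simp: w_def orthonormal_def)
  have w: "dot m (w i) (w j) = (if i = j then s i else 0)" if "i < d" "j < d" for i j
    using w_lt[of i j] w_lt[of j i] that
    by (cases i j rule: linorder_cases) (auto simp: s_def dot_commute)
  have decomp: "A $$ (i, j) = (\<Sum>l<d. w l i * v l j)" if "i < m" "j < d" for i j
  proof -
    have "(\<Sum>l<d. w l i * v l j) = (\<Sum>l<d. \<Sum>k<d. M (i, k) * (v l k * v l j))"
      by (simp add: w_def mat_app_def sum_distrib_right mult.assoc)
    also have "\<dots> = (\<Sum>k<d. M (i, k) * (\<Sum>l<d. v l k * v l j))"
      by (subst sum.swap) (simp add: sum_distrib_left)
    also have "\<dots> = (\<Sum>k<d. if k = j then M (i, k) else 0)"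
      using complete that by (intro sum.cong) auto
    finally show ?thesis using that by (simp add: M_def)
  qed
  have gram: "(\<Sum>a<m. A $$ (a, i) * A $$ (a, j)) = (\<Sum>l<d. s l * (v l i * v l j))"
    if "i < d" "j < d" for i j
  proof -
    have "(\<Sum>a<m. A $$ (a, i) * A $$ (a, j)) =
        (\<Sum>a<m. \<Sum>l<d. \<Sum>l'<d. (w l a * w l' a) * (v l i * v l' j))"
      using that by (simp add: decomp sum_product mult_ac)
    also have "\<dots> = (\<Sum>l<d. \<Sum>l'<d. \<Sum>a<m. (w l a * w l' a) * (v l i * v l' j))"
      by (rule trans[OF sum.swap]) (intro sum.cong refl sum.swap)
    also have "\<dots> = (\<Sum>l<d. \<Sum>l'<d. if l = l' then s l * (v l i * v l' j) else 0)"
    proof (intro sum.cong refl)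
      fix l l' assume "l \<in> {..<d}" "l' \<in> {..<d}"
      then show "(\<Sum>a<m. (w l a * w l' a) * (v l i * v l' j)) =
          (if l = l' then s l * (v l i * v l' j) else 0)"
        using w[of l l'] by (simp add: sum_distrib_right[symmetric] dot_def)
    qed
    finally show ?thesis by simp
  qed
  define V where "V = Matrix.mat d d (\<lambda>(i, j). v j i)"
  define D where "D = Matrix.mat d d (\<lambda>(i, j). if i = j then s i else 0)"
  have V: "V \<in> carrier_mat d d" and D: "D \<in> carrier_mat d d"
    by (simp_all add: V_def D_def)
  have G: "transpose_mat A * A \<in> carrier_mat d d"
    using A by simp
  have "similar_mat_wit (transpose_mat A * A) D V (transpose_mat V)"
  proof (rule similar_mat_witI[of _ _ d])
    show "V * transpose_mat V = 1\<^sub>m d"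
      by (rule eq_matI) (auto simp: V_def scalar_prod_def complete atLeast0LessThan)
    show "transpose_mat V * V = 1\<^sub>m d"
      using v by (intro eq_matI)
        (auto simp: V_def scalar_prod_def orthonormal_def dot_def atLeast0LessThan)
    show "transpose_mat A * A = V * D * transpose_mat V"
    proof (rule eq_matI)
      fix i j assume ij: "i < dim_row (V * D * transpose_mat V)" "j < dim_col (V * D * transpose_mat V)"
      then have ij: "i < d" "j < d" by (simp_all add: V_def)
      have "(V * D) $$ (i, l) = s l * v l i" if "l < d" for l
      proof -
        have "(V * D) $$ (i, l) = (\<Sum>k<d. v k i * (if k = l then s k else 0))"
          using ij that by (simp add: V_def D_def scalar_prod_def atLeast0LessThan)
        also have "\<dots> = (\<Sum>k<d. if k = l then s k * v k i else 0)"
          by (intro sum.cong) auto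
        finally show ?thesis using that by simp
      qed
      moreover define E where "E = V * D"
      moreover have "E \<in> carrier_mat d d" using V D by (simp add: E_def)
      moreover have "(E * transpose_mat V) $$ (i, j) = (\<Sum>l<d. E $$ (i, l) * v l j)"
        using ij \<open>E \<in> carrier_mat d d\<close> by (simp add: scalar_prod_def atLeast0LessThan V_def)
      ultimately have "(V * D * transpose_mat V) $$ (i, j) = (\<Sum>l<d. s l * v l i * v l j)"
        by simp
      also have "\<dots> = (transpose_mat A * A) $$ (i, j)"
        using gram[OF ij] ij A by (simp add: scalar_prod_def atLeast0LessThan mult.assoc)
      finally show "(transpose_mat A * A) $$ (i, j) = (V * D * transpose_mat V) $$ (i, j)" ..
    qed (use A V D in auto)
  qed (use V D G in auto)
  then have "similar_mat (transpose_mat A * A) D"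
    unfolding similar_mat_def by blast
  then have "char_poly (transpose_mat A * A) = char_poly D"
    by (rule char_poly_similar)
  also have "\<dots> = (\<Prod>a\<leftarrow>diag_mat D. [:- a, 1:])"
    by (rule char_poly_upper_triangular[OF D]) (auto simp: D_def)
  also have "diag_mat D = map s [0..<d]"
    by (auto simp: diag_mat_def D_def)
  finally have cp: "char_poly (transpose_mat A * A) = (\<Prod>l\<leftarrow>[0..<d]. [:- s l, 1:])"
    by (simp add: o_def)
  have "proots (\<Prod>l\<leftarrow>ls. [:- s l, 1:]) = mset (map s ls)" for ls
  proof (induction ls)
    case (Cons l ls)
    have "(\<Prod>l\<leftarrow>ls. [:- s l, 1:]) \<noteq> 0"
      by (auto simp: prod_list_zero_iff)
    with Cons show ?case
      by (simp add: proots_mult del: mult_pCons_left)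
  qed simp
  then have "nuclear_norm A = (\<Sum>l<d. sqrt (s l))"
    by (simp add: nuclear_norm_def singular_values_def cp image_mset.compositionality o_def
        sum_mset_sum_list mset_map[symmetric] interv_sum_list_conv_sum_set_nat
        atLeast0LessThan del: mset_map)
  moreover have "(frobenius_norm A)\<^sup>2 = (\<Sum>j<d. \<Sum>i<m. A $$ (i, j) * A $$ (i, j))"
    using A by (subst sum.swap) (simp add: frobenius_norm_def sum_nonneg power2_eq_square)
  moreover have "(\<Sum>j<d. \<Sum>i<m. A $$ (i, j) * A $$ (i, j)) = (\<Sum>l<d. s l * dot d (v l) (v l))"
    unfolding dot_def sum_distrib_left by (subst sum.swap) (simp add: gram)
  moreover have "\<dots> = (\<Sum>l<d. s l)"
    using v by (simp add: orthonormal_def)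
  ultimately show ?thesis
    using v decomp by (intro exI[of _ w] exI[of _ v]) (simp add: s_def)
qed

section \<open>Nets of unit balls\<close>

definition half_net :: "(('i \<Rightarrow> real) \<Rightarrow> real) \<Rightarrow> ('i \<Rightarrow> real) set \<Rightarrow> bool" where
  "half_net p N \<longleftrightarrow> (\<forall>y\<in>N. p y \<le> 1) \<and>
    (\<forall>x. p x \<le> 1 \<longrightarrow> (\<exists>y\<in>N. p (\<lambda>i. x i - y i) \<le> 1 / 2))"

text \<open>
  A norm on the real functions on a finite set \<open>I\<close>, regarded as a seminorm on all functions on the
  type, with explicit comparison to the maximum norm. The dimension \<open>card I\<close> is thus a value.
\<close>
locale coordinate_norm =
  fixes I :: "'i set" and p :: "('i \<Rightarrow> real) \<Rightarrow> real" and K :: real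
  assumes finite_index: "finite I"
    and triangle: "p (\<lambda>i. x i + y i) \<le> p x + p y"
    and scale: "p (\<lambda>i. c * x i) \<le> \<bar>c\<bar> * p x"
    and coordinates_bounded: "i \<in> I \<Longrightarrow> \<bar>x i\<bar> \<le> p x"
    and bounded_by_coordinates: "0 \<le> h \<Longrightarrow> (\<And>i. i \<in> I \<Longrightarrow> \<bar>x i\<bar> \<le> h) \<Longrightarrow> p x \<le> K * h"
begin

lemma uminus_le: "p (\<lambda>i. - x i) \<le> p x"
  using scale[of "-1" x] by simp

lemma nonneg: "0 \<le> p x"
proof -
  have "0 \<le> p (\<lambda>i. 0)"
    using triangle[of "\<lambda>i. 0" "\<lambda>i. 0"] by simp
  also have "\<dots> \<le> p x + p (\<lambda>i. - x i)"
    using triangle[of x "\<lambda>i. - x i"] by simp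
  finally show ?thesis using uminus_le[of x] by linarith
qed

lemma diff_commute_le: "p (\<lambda>i. x i - y i) \<le> p (\<lambda>i. y i - x i)"
  using uminus_le[of "\<lambda>i. y i - x i"] by simp

lemma diff_triangle: "p (\<lambda>i. x i - z i) \<le> p (\<lambda>i. x i - y i) + p (\<lambda>i. y i - z i)"
  using triangle[of "\<lambda>i. x i - y i" "\<lambda>i. y i - z i"] by simp

lemma eq_zero: "(\<And>i. i \<in> I \<Longrightarrow> x i = 0) \<Longrightarrow> p x = 0"
  using bounded_by_coordinates[of 0 x] nonneg[of x] by simp

lemma diff_eq_on: "(\<And>i. i \<in> I \<Longrightarrow> x i = y i) \<Longrightarrow> p x \<le> p y"
  using triangle[of "\<lambda>i. x i - y i" y] eq_zero[of "\<lambda>i. x i - y i"] by simp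

text \<open>
  The mesh is so fine that rounding to the lattice \<open>mesh \<int>\<^sup>I\<close> moves a point by at most \<open>1 / 100\<close>.
  Counting the points of this lattice is used instead of volume.
\<close>
definition mesh :: real where "mesh = 1 / (100 * (\<bar>K\<bar> + 1))"

definition lattice_point :: "('i \<Rightarrow> int) \<Rightarrow> 'i \<Rightarrow> real" where
  "lattice_point k = (\<lambda>i. mesh * real_of_int (k i))"

definition lattice_ball :: "real \<Rightarrow> ('i \<Rightarrow> int) set" where
  "lattice_ball \<rho> = {k \<in> I \<rightarrow>\<^sub>E UNIV. p (lattice_point k) \<le> \<rho>}"

lemma mesh_pos: "0 < mesh"
  by (simp add: mesh_def add_nonneg_pos)

lemma within_mesh:
  assumes "\<And>i. i \<in> I \<Longrightarrow> \<bar>x i\<bar> \<le> mesh"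
  shows "p x \<le> 1 / 100"
proof -
  have "p x \<le> K * mesh"
    using bounded_by_coordinates[of mesh x] assms mesh_pos by simp
  also have "\<dots> \<le> (\<bar>K\<bar> + 1) * mesh"
    using mesh_pos by (intro mult_right_mono) auto
  also have "\<dots> = 1 / 100"
  proof -
    have "\<bar>K\<bar> + 1 \<noteq> 0" by linarith
    then show ?thesis by (simp add: mesh_def)
  qed
  finally show ?thesis .
qed

lemma finite_lattice_ball: "finite (lattice_ball \<rho>)"
proof -
  define z where "z = \<lceil>\<rho> / mesh\<rceil>"
  have "lattice_ball \<rho> \<subseteq> I \<rightarrow>\<^sub>E {- z..z}"
  proof
    fix k assume k: "k \<in> lattice_ball \<rho>"
    have "k i \<in> {- z..z}" if "i \<in> I" for i
    proof -
      have "mesh * \<bar>real_of_int (k i)\<bar> \<le> \<rho>"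
        using coordinates_bounded[OF that, of "lattice_point k"] k mesh_pos
        by (simp add: lattice_point_def lattice_ball_def abs_mult)
      then have "\<bar>real_of_int (k i)\<bar> \<le> \<rho> / mesh"
        using mesh_pos by (simp add: field_simps)
      then have "\<bar>real_of_int (k i)\<bar> \<le> real_of_int z"
        unfolding z_def by linarith
      then show ?thesis by auto
    qed
    then show "k \<in> I \<rightarrow>\<^sub>E {- z..z}"
      using k by (auto simp: lattice_ball_def)
  qed
  then show ?thesis
    by (rule finite_subset) (simp add: finite_PiE finite_index)
qed

lemma lattice_ball_nonempty: "0 \<le> \<rho> \<Longrightarrow> 0 < card (lattice_ball \<rho>)"
proof -
  assume "0 \<le> \<rho>"
  then have "(\<lambda>i\<in>I. 0) \<in> lattice_ball \<rho>"
    using eq_zero[of "lattice_point (\<lambda>i\<in>I. 0)"] by (auto simp: lattice_ball_def lattice_point_def)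
  then show ?thesis using finite_lattice_ball card_gt_0_iff by blast
qed

text \<open>
  Dividing all coordinates by \<open>7\<close> and rounding down maps the large ball into the small one, since
  \<open>(5 / 4) / 7 + 1 / 100 \<le> 1 / 5\<close>, and at most \<open>7 ^ card I\<close> points have the same image. This is
  the discrete form of the scaling of volume.
\<close>
lemma lattice_ball_growth:
  "card (lattice_ball (5 / 4)) \<le> card (lattice_ball (1 / 5)) * 7 ^ card I"
proof -
  have "lattice_ball (5 / 4) \<subseteq>
      (\<Union>a\<in>lattice_ball (1 / 5). \<Pi>\<^sub>E i\<in>I. {7 * a i..<7 * a i + 7})"
  proof
    fix k assume k: "k \<in> lattice_ball (5 / 4)"
    define a where "a = (\<lambda>i\<in>I. k i div 7)"
    have "p (lattice_point a) \<le>
        p (\<lambda>i. 1 / 7 * lattice_point k i) + p (\<lambda>i. lattice_point a i - 1 / 7 * lattice_point k i)"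
      using triangle[of "\<lambda>i. 1 / 7 * lattice_point k i"
        "\<lambda>i. lattice_point a i - 1 / 7 * lattice_point k i"] by simp
    moreover have "p (\<lambda>i. 1 / 7 * lattice_point k i) \<le> 1 / 7 * (5 / 4)"
      using scale[of "1 / 7" "lattice_point k"] k by (simp add: lattice_ball_def)
    moreover have "p (\<lambda>i. lattice_point a i - 1 / 7 * lattice_point k i) \<le> 1 / 100"
    proof (rule within_mesh)
      fix i assume "i \<in> I"
      \<comment> \<open>Rounding down changes \<open>k i / 7\<close> by less than one lattice step.\<close>
      have "k i = 7 * (k i div 7) + k i mod 7" by simp
      then have "real_of_int (k i) = 7 * real_of_int (k i div 7) + real_of_int (k i mod 7)"
        by (metis of_int_add of_int_mult of_int_numeral)
      then have "real_of_int (k i div 7) - real_of_int (k i) / 7 = - real_of_int (k i mod 7) / 7"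
        by (simp add: add_divide_distrib)
      moreover have "0 \<le> k i mod 7" "k i mod 7 < 7" by simp_all
      then have "0 \<le> real_of_int (k i mod 7)" "real_of_int (k i mod 7) \<le> 7" by linarith+
      ultimately have "\<bar>real_of_int (k i div 7) - real_of_int (k i) / 7\<bar> \<le> 1"
        by simp
      then have "mesh * \<bar>real_of_int (k i div 7) - real_of_int (k i) / 7\<bar> \<le> mesh * 1"
        using mesh_pos by (intro mult_left_mono) auto
      moreover have "lattice_point a i - 1 / 7 * lattice_point k i =
          mesh * (real_of_int (k i div 7) - real_of_int (k i) / 7)"
        using \<open>i \<in> I\<close> by (simp add: lattice_point_def a_def right_diff_distrib)
      ultimately show "\<bar>lattice_point a i - 1 / 7 * lattice_point k i\<bar> \<le> mesh"
        using mesh_pos by (simp add: abs_mult)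
    qed
    ultimately have "p (lattice_point a) \<le> 1 / 5" by simp
    then have "a \<in> lattice_ball (1 / 5)" by (auto simp: lattice_ball_def a_def)
    moreover have "k \<in> (\<Pi>\<^sub>E i\<in>I. {7 * a i..<7 * a i + 7})"
    proof (rule PiE_I)
      fix i assume "i \<in> I"
      have "7 * (k i div 7) \<le> k i" "k i < 7 * (k i div 7) + 7" by presburger+
      with \<open>i \<in> I\<close> show "k i \<in> {7 * a i..<7 * a i + 7}" by (simp add: a_def)
    qed (use k in \<open>auto simp: lattice_ball_def\<close>)
    ultimately show "k \<in> (\<Union>a\<in>lattice_ball (1 / 5). \<Pi>\<^sub>E i\<in>I. {7 * a i..<7 * a i + 7})" by blast
  qed
  then have "card (lattice_ball (5 / 4)) \<le>
      card (\<Union>a\<in>lattice_ball (1 / 5). \<Pi>\<^sub>E i\<in>I. {7 * a i..<7 * a i + 7})"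
    by (intro card_mono finite_UN_I finite_lattice_ball finite_PiE finite_index) auto
  also have "\<dots> \<le> (\<Sum>a\<in>lattice_ball (1 / 5). card (\<Pi>\<^sub>E i\<in>I. {7 * a i..<7 * a i + 7}))"
    by (rule card_UN_le) (rule finite_lattice_ball)
  also have "\<dots> = card (lattice_ball (1 / 5)) * 7 ^ card I"
    by (simp add: card_PiE finite_index)
  finally show ?thesis .
qed

text \<open>
  The translates of the ball of radius \<open>1 / 5\<close> by the rounded points of \<open>S\<close> are disjoint and lie in
  the ball of radius \<open>5 / 4\<close>.
\<close>
lemma separated_card_le:
  assumes S: "finite S" "\<And>x. x \<in> S \<Longrightarrow> p x \<le> 1"
    and separated: "\<And>x y. x \<in> S \<Longrightarrow> y \<in> S \<Longrightarrow> x \<noteq> y \<Longrightarrow> 1 / 2 < p (\<lambda>i. x i - y i)"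
  shows "card S \<le> 7 ^ card I"
proof -
  define rnd :: "('i \<Rightarrow> real) \<Rightarrow> 'i \<Rightarrow> int" where "rnd = (\<lambda>x i. \<lfloor>x i / mesh\<rfloor>)"
  have rnd: "p (\<lambda>i. x i - lattice_point (rnd x) i) \<le> 1 / 100" for x
  proof (rule within_mesh)
    fix i
    have "0 \<le> x i / mesh - real_of_int \<lfloor>x i / mesh\<rfloor>" "x i / mesh - real_of_int \<lfloor>x i / mesh\<rfloor> \<le> 1"
      by linarith+
    then have "\<bar>x i / mesh - real_of_int \<lfloor>x i / mesh\<rfloor>\<bar> * mesh \<le> 1 * mesh"
      using mesh_pos by (intro mult_right_mono) auto
    moreover have "x i - lattice_point (rnd x) i = (x i / mesh - real_of_int \<lfloor>x i / mesh\<rfloor>) * mesh"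
      using mesh_pos by (simp add: lattice_point_def rnd_def field_simps)
    ultimately show "\<bar>x i - lattice_point (rnd x) i\<bar> \<le> mesh"
      using mesh_pos by (simp add: abs_mult)
  qed
  define g where "g = (\<lambda>(x, a). \<lambda>i\<in>I. rnd x i + a i)"
  have "inj_on g (S \<times> lattice_ball (1 / 5))"
  proof (rule inj_onI, clarify)
    fix x a y b
    assume x: "x \<in> S" and y: "y \<in> S" and a: "a \<in> lattice_ball (1 / 5)"
      and b: "b \<in> lattice_ball (1 / 5)" and eq: "g (x, a) = g (y, b)"
    have eq: "rnd x i + a i = rnd y i + b i" if "i \<in> I" for i
      using fun_cong[OF eq, of i] that by (simp add: g_def)
    have "p (\<lambda>i. lattice_point (rnd x) i - lattice_point (rnd y) i) \<le>
        p (\<lambda>i. lattice_point b i + - lattice_point a i)"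
    proof (rule diff_eq_on)
      fix i assume "i \<in> I"
      from eq[OF this] have "rnd x i - rnd y i = b i - a i" by simp
      then have "real_of_int (rnd x i) - real_of_int (rnd y i) = real_of_int (b i) - real_of_int (a i)"
        by (metis of_int_diff)
      then show "lattice_point (rnd x) i - lattice_point (rnd y) i =
          lattice_point b i + - lattice_point a i"
        by (simp add: lattice_point_def right_diff_distrib[symmetric])
    qed
    also have "\<dots> \<le> p (lattice_point b) + p (\<lambda>i. - lattice_point a i)"
      by (rule triangle)
    also have "\<dots> \<le> 1 / 5 + 1 / 5"
      using a b uminus_le[of "lattice_point a"] by (simp add: lattice_ball_def)
    finally have "p (\<lambda>i. x i - y i) \<le> 1 / 2"
      using diff_triangle[of x y "lattice_point (rnd x)"] rnd[of x] rnd[of y]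
        diff_triangle[of "lattice_point (rnd x)" y "lattice_point (rnd y)"]
        diff_commute_le[of "lattice_point (rnd y)" y] by linarith
    then have "x = y" using separated[OF x y] by force
    moreover have "a = b"
      using a b eq \<open>x = y\<close> by (intro PiE_ext[of a I "\<lambda>_. UNIV" b]) (auto simp: lattice_ball_def)
    ultimately show "x = y \<and> a = b" ..
  qed
  moreover have "g ` (S \<times> lattice_ball (1 / 5)) \<subseteq> lattice_ball (5 / 4)"
  proof clarify
    fix x a assume x: "x \<in> S" and a: "a \<in> lattice_ball (1 / 5)"
    have "p (lattice_point (g (x, a))) \<le> p (\<lambda>i. lattice_point (rnd x) i + lattice_point a i)"
      by (rule diff_eq_on) (simp add: lattice_point_def g_def distrib_left)
    also have "\<dots> \<le> p (lattice_point (rnd x)) + p (lattice_point a)"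
      by (rule triangle)
    also have "p (lattice_point (rnd x)) \<le> 1 + 1 / 100"
      using triangle[of x "\<lambda>i. lattice_point (rnd x) i - x i"] S(2)[OF x] rnd[of x]
        diff_commute_le[of "lattice_point (rnd x)" x] by simp
    finally show "g (x, a) \<in> lattice_ball (5 / 4)"
      using a by (simp add: lattice_ball_def g_def)
  qed
  ultimately have "card (S \<times> lattice_ball (1 / 5)) \<le> card (lattice_ball (5 / 4))"
    using card_inj_on_le finite_lattice_ball by blast
  also note lattice_ball_growth
  finally have "card S * card (lattice_ball (1 / 5)) \<le> 7 ^ card I * card (lattice_ball (1 / 5))"
    by (simp add: card_cartesian_product mult.commute)
  then show ?thesis
    using lattice_ball_nonempty[of "1 / 5"] by simp
qed

text \<open>
  A separated subset of the ball with the largest number of points is a net.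
\<close>
lemma ball_net:
  "\<exists>N. finite N \<and> card N \<le> 7 ^ card I \<and> half_net p N"
proof -
  define P where "P = (\<lambda>S. finite S \<and> (\<forall>x\<in>S. p x \<le> 1) \<and>
    (\<forall>x\<in>S. \<forall>y\<in>S. x \<noteq> y \<longrightarrow> 1 / 2 < p (\<lambda>i. x i - y i)))"
  have bound: "card S \<le> 7 ^ card I" if "P S" for S
    using that unfolding P_def by (intro separated_card_le) blast+
  have "P {}" by (simp add: P_def)
  then obtain N where N: "P N" "\<And>S. P S \<Longrightarrow> card S \<le> card N"
    using ex_has_greatest_nat[of P "{}" card "Suc (7 ^ card I)"] bound by (auto simp: less_Suc_eq_le)
  have "\<exists>y\<in>N. p (\<lambda>i. x i - y i) \<le> 1 / 2" if x: "p x \<le> 1" for x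
  proof (rule ccontr)
    assume "\<not> ?thesis"
    then have far: "1 / 2 < p (\<lambda>i. x i - y i)" if "y \<in> N" for y
      using that by force
    then have far': "1 / 2 < p (\<lambda>i. y i - x i)" if "y \<in> N" for y
      using that diff_commute_le[of x y] by fastforce
    have "x \<notin> N" using far[of x] eq_zero[of "\<lambda>i. 0"] by auto
    have "P (insert x N)"
      using N(1) x far far' by (auto simp: P_def)
    then show False
      using N(2)[of "insert x N"] \<open>x \<notin> N\<close> N(1) by (simp add: P_def)
  qed
  then show ?thesis
    using N(1) bound[OF N(1)] by (intro exI[of _ N]) (auto simp: P_def half_net_def)
qed

text \<open>
  If \<open>s\<close> is the supremum of the form over the unit ball, then approximation of a point by the net
  costs at most \<open>s / 2\<close>, so \<open>s \<le> b + s / 2\<close>.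
\<close>
lemma linear_form_net_bound:
  assumes net: "half_net p N"
    and bound: "\<And>y. y \<in> N \<Longrightarrow> \<bar>\<Sum>i\<in>I. c i * y i\<bar> \<le> b"
  shows "\<bar>\<Sum>i\<in>I. c i * x i\<bar> \<le> 2 * b * p x"
proof -
  define f where "f = (\<lambda>x. \<Sum>i\<in>I. c i * x i)"
  have f_scale: "f (\<lambda>i. t * x i) = t * f x" for t x
    by (simp add: f_def sum_distrib_left mult_ac)
  have f_diff: "f (\<lambda>i. x i - y i) = f x - f y" for x y
    by (simp add: f_def right_diff_distrib sum_subtractf)
  have crude: "\<bar>f x\<bar> \<le> (\<Sum>i\<in>I. \<bar>c i\<bar>) * p x" for x
  proof -
    have "\<bar>f x\<bar> \<le> (\<Sum>i\<in>I. \<bar>c i\<bar> * \<bar>x i\<bar>)"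
      unfolding f_def abs_mult[symmetric] by (rule sum_abs)
    also have "\<dots> \<le> (\<Sum>i\<in>I. \<bar>c i\<bar> * p x)"
      by (intro sum_mono mult_left_mono coordinates_bounded) auto
    finally show ?thesis by (simp add: sum_distrib_right)
  qed
  have zero: "p (\<lambda>i. 0) = 0" by (rule eq_zero) simp
  define s where "s = (SUP x\<in>{x. p x \<le> 1}. \<bar>f x\<bar>)"
  have bdd: "bdd_above ((\<lambda>x. \<bar>f x\<bar>) ` {x. p x \<le> 1})"
  proof (rule bdd_aboveI2)
    fix x assume "x \<in> {x. p x \<le> 1}"
    then show "\<bar>f x\<bar> \<le> (\<Sum>i\<in>I. \<bar>c i\<bar>)"
      using crude[of x] mult_left_mono[of "p x" 1 "\<Sum>i\<in>I. \<bar>c i\<bar>"] by (simp add: sum_nonneg)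
  qed
  have le_s: "\<bar>f x\<bar> \<le> s" if "p x \<le> 1" for x
    unfolding s_def using bdd by (rule cSUP_upper2) (use that in auto)
  have homog: "\<bar>f x\<bar> \<le> s * p x" for x
  proof (cases "p x = 0")
    case True
    then show ?thesis using crude[of x] by simp
  next
    case False
    then have pos: "0 < p x" using nonneg[of x] by simp
    have "p (\<lambda>i. (1 / p x) * x i) \<le> 1"
      using scale[of "1 / p x" x] pos by simp
    from le_s[OF this, unfolded f_scale] show ?thesis
      using pos by (simp add: abs_mult field_simps)
  qed
  have "s \<le> b + s / 2"
    unfolding s_def
  proof (rule cSUP_least, fold s_def)
    show "{x. p x \<le> 1} \<noteq> {}" using zero by (auto intro!: exI[of _ "\<lambda>i. 0"])
    fix x assume "x \<in> {x. p x \<le> 1}"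
    with net[unfolded half_net_def] obtain y where y: "y \<in> N" "p (\<lambda>i. x i - y i) \<le> 1 / 2" by blast
    have "0 \<le> s" using le_s[of "\<lambda>i. 0"] zero by simp
    then have "s * p (\<lambda>i. x i - y i) \<le> s * (1 / 2)" using y(2) by (intro mult_left_mono)
    then have "\<bar>f x - f y\<bar> \<le> s / 2" using homog[of "\<lambda>i. x i - y i"] by (simp add: f_diff)
    moreover have "\<bar>f y\<bar> \<le> b" using bound[OF y(1)] by (simp add: f_def)
    ultimately show "\<bar>f x\<bar> \<le> b + s / 2" by linarith
  qed
  then have "s * p x \<le> 2 * b * p x" using nonneg[of x] by (intro mult_right_mono) auto
  then show ?thesis using homog[of x] by (simp add: f_def)
qed

end


lemma sum_Times: "(\<Sum>q\<in>A \<times> B. f q) = (\<Sum>i\<in>A. \<Sum>j\<in>B. f (i, j))"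
  by (simp add: sum.cartesian_product)

lemma L2_set_product:
  "L2_set x (A \<times> B) = L2_set (\<lambda>i. L2_set (\<lambda>j. x (i, j)) B) A"
proof -
  have "(\<Sum>p\<in>A \<times> B. (x p)\<^sup>2) = (\<Sum>i\<in>A. \<Sum>j\<in>B. (x (i, j))\<^sup>2)"
    by (rule sum_Times)
  then show ?thesis by (simp add: L2_set_def sum_nonneg)
qed

lemma L2_set_scale: "L2_set (\<lambda>i. c * x i) A = \<bar>c\<bar> * L2_set x A"
  by (simp add: L2_set_def power_mult_distrib sum_distrib_left[symmetric] real_sqrt_mult)

lemma abs_le_L2_set: "finite A \<Longrightarrow> i \<in> A \<Longrightarrow> \<bar>x i\<bar> \<le> L2_set x A"
  using member_le_L2_set[of A i "\<lambda>i. \<bar>x i\<bar>"] by (simp add: L2_set_def)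

lemma L2_set_coordinate_norm:
  assumes "finite I"
  shows "coordinate_norm I (\<lambda>x. L2_set x I) (real (card I))"
proof
  show "L2_set (\<lambda>i. x i + y i) I \<le> L2_set x I + L2_set y I" for x y
    by (rule L2_set_triangle_ineq)
  show "L2_set (\<lambda>i. c * x i) I \<le> \<bar>c\<bar> * L2_set x I" for c x
    by (simp add: L2_set_scale)
  show "\<bar>x i\<bar> \<le> L2_set x I" if "i \<in> I" for x i
    using assms that by (rule abs_le_L2_set)
  show "L2_set x I \<le> real (card I) * h" if "\<And>i. i \<in> I \<Longrightarrow> \<bar>x i\<bar> \<le> h" for x h
    using order_trans[OF L2_set_le_sum_abs sum_bounded_above[of I "\<lambda>i. \<bar>x i\<bar>" h]] that
    by simp
qed (rule assms)

definition operator_norm :: "nat \<Rightarrow> nat \<Rightarrow> (nat \<times> nat \<Rightarrow> real) \<Rightarrow> real" where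
  "operator_norm d r V =
    (SUP x\<in>{x. L2_set x {..<r} \<le> 1}. L2_set (\<lambda>j. \<Sum>l<r. V (j, l) * x l) {..<d})"

lemma bdd_above_operator_norm:
  fixes d r :: nat
  shows "bdd_above ((\<lambda>x. L2_set (\<lambda>j. \<Sum>l<r. V (j, l) * x l) {..<d}) ` {x. L2_set x {..<r} \<le> 1})"
proof (rule bdd_aboveI2)
  fix x :: "nat \<Rightarrow> real" assume "x \<in> {x. L2_set x {..<r} \<le> 1}"
  then have x: "\<bar>x l\<bar> \<le> 1" if "l < r" for l
    using abs_le_L2_set[of "{..<r}" l x] that by simp
  have "L2_set (\<lambda>j. \<Sum>l<r. V (j, l) * x l) {..<d} \<le> (\<Sum>j<d. \<bar>\<Sum>l<r. V (j, l) * x l\<bar>)"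
    by (rule L2_set_le_sum_abs)
  also have "\<dots> \<le> (\<Sum>j<d. \<Sum>l<r. \<bar>V (j, l) * x l\<bar>)"
    by (intro sum_mono sum_abs)
  also have "\<dots> \<le> (\<Sum>j<d. \<Sum>l<r. \<bar>V (j, l)\<bar>)"
    using x by (intro sum_mono) (auto simp: abs_mult intro: mult_left_le)
  finally show "L2_set (\<lambda>j. \<Sum>l<r. V (j, l) * x l) {..<d} \<le> (\<Sum>j<d. \<Sum>l<r. \<bar>V (j, l)\<bar>)" .
qed

lemma operator_norm_upper:
  "L2_set x {..<r} \<le> 1 \<Longrightarrow> L2_set (\<lambda>j. \<Sum>l<r. V (j, l) * x l) {..<d} \<le> operator_norm d r V"
  unfolding operator_norm_def by (rule cSUP_upper[OF _ bdd_above_operator_norm]) simp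

lemma operator_norm_least:
  assumes "\<And>x. L2_set x {..<r} \<le> 1 \<Longrightarrow> L2_set (\<lambda>j. \<Sum>l<r. V (j, l) * x l) {..<d} \<le> b"
  shows "operator_norm d r V \<le> b"
  unfolding operator_norm_def
proof (rule cSUP_least)
  show "{x :: nat \<Rightarrow> real. L2_set x {..<r} \<le> 1} \<noteq> {}"
    by (auto intro!: exI[of _ "\<lambda>_. 0"] simp: L2_set_def)
qed (use assms in auto)

lemma L2_set_le_operator_norm:
  "L2_set (\<lambda>j. \<Sum>l<r. V (j, l) * x l) {..<d} \<le> operator_norm d r V * L2_set x {..<r}"
proof (cases "L2_set x {..<r} = 0")
  case True
  then have "x l = 0" if "l < r" for l using that by (simp add: L2_set_eq_0_iff)
  then have "L2_set (\<lambda>j. \<Sum>l<r. V (j, l) * x l) {..<d} = 0" by (simp add: L2_set_def)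
  then show ?thesis using True by simp
next
  case False
  define t where "t = L2_set x {..<r}"
  have t: "t > 0" using False L2_set_nonneg[of x "{..<r}"] unfolding t_def by linarith
  have "L2_set (\<lambda>l. 1 / t * x l) {..<r} \<le> 1"
    unfolding L2_set_scale using t by (simp add: t_def)
  from operator_norm_upper[OF this, of V d]
  have "L2_set (\<lambda>j. 1 / t * (\<Sum>l<r. V (j, l) * x l)) {..<d} \<le> operator_norm d r V"
    by (simp add: sum_divide_distrib)
  then have "L2_set (\<lambda>j. \<Sum>l<r. V (j, l) * x l) {..<d} / t \<le> operator_norm d r V"
    unfolding L2_set_scale using t by simp
  then show ?thesis using t by (simp add: t_def field_simps)
qed

lemma operator_norm_coordinate_norm:
  "coordinate_norm ({..<d} \<times> {..<r}) (operator_norm d r) (real d * real r)"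
proof
  fix V V' :: "nat \<times> nat \<Rightarrow> real" and c h :: real and q
  show "operator_norm d r (\<lambda>q. V q + V' q) \<le> operator_norm d r V + operator_norm d r V'"
  proof (rule operator_norm_least)
    fix x :: "nat \<Rightarrow> real" assume x: "L2_set x {..<r} \<le> 1"
    have "L2_set (\<lambda>j. \<Sum>l<r. (V (j, l) + V' (j, l)) * x l) {..<d} \<le>
        L2_set (\<lambda>j. \<Sum>l<r. V (j, l) * x l) {..<d} + L2_set (\<lambda>j. \<Sum>l<r. V' (j, l) * x l) {..<d}"
      unfolding distrib_right sum.distrib by (rule L2_set_triangle_ineq)
    then show "L2_set (\<lambda>j. \<Sum>l<r. (V (j, l) + V' (j, l)) * x l) {..<d} \<le>
        operator_norm d r V + operator_norm d r V'"
      using operator_norm_upper[OF x, of V d] operator_norm_upper[OF x, of V' d] by linarith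
  qed
  show "operator_norm d r (\<lambda>q. c * V q) \<le> \<bar>c\<bar> * operator_norm d r V"
  proof (rule operator_norm_least)
    fix x :: "nat \<Rightarrow> real" assume x: "L2_set x {..<r} \<le> 1"
    have "L2_set (\<lambda>j. \<Sum>l<r. c * V (j, l) * x l) {..<d} =
        \<bar>c\<bar> * L2_set (\<lambda>j. \<Sum>l<r. V (j, l) * x l) {..<d}"
      unfolding L2_set_scale[symmetric] by (simp add: sum_distrib_left mult.assoc)
    also have "\<dots> \<le> \<bar>c\<bar> * operator_norm d r V"
      by (intro mult_left_mono operator_norm_upper x) simp
    finally show "L2_set (\<lambda>j. \<Sum>l<r. c * V (j, l) * x l) {..<d} \<le> \<bar>c\<bar> * operator_norm d r V" .
  qed
  show "\<bar>V q\<bar> \<le> operator_norm d r V" if qI: "q \<in> {..<d} \<times> {..<r}"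
  proof -
    obtain j l where q: "q = (j, l)" "j < d" "l < r" using qI by auto
    define e where "e = (\<lambda>i. if i = l then 1 else 0 :: real)"
    have "L2_set e {..<r} = 1"
      using q by (simp add: L2_set_def e_def if_distrib[of "\<lambda>t. t\<^sup>2"] cong: if_cong)
    moreover have "(\<Sum>i<r. V (j, i) * e i) = V (j, l)" for j
      using q by (simp add: e_def if_distrib[of "\<lambda>t. _ * t"] cong: if_cong)
    ultimately have "L2_set (\<lambda>j. V (j, l)) {..<d} \<le> operator_norm d r V"
      using operator_norm_upper[of e r V d] by simp
    then show ?thesis
      using abs_le_L2_set[of "{..<d}" j "\<lambda>j. V (j, l)"] q by simp
  qed
  show "operator_norm d r V \<le> real d * real r * h"
    if "0 \<le> h" "\<And>q. q \<in> {..<d} \<times> {..<r} \<Longrightarrow> \<bar>V q\<bar> \<le> h"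
  proof (rule operator_norm_least)
    fix x :: "nat \<Rightarrow> real" assume "L2_set x {..<r} \<le> 1"
    then have x: "\<bar>x l\<bar> \<le> 1" if "l < r" for l
      using abs_le_L2_set[of "{..<r}" l x] that by simp
    have "L2_set (\<lambda>j. \<Sum>l<r. V (j, l) * x l) {..<d} \<le> (\<Sum>j<d. \<bar>\<Sum>l<r. V (j, l) * x l\<bar>)"
      by (rule L2_set_le_sum_abs)
    also have "\<dots> \<le> (\<Sum>j<d. \<Sum>l<r. \<bar>V (j, l) * x l\<bar>)"
      by (intro sum_mono sum_abs)
    also have "\<dots> \<le> (\<Sum>j<d. \<Sum>l<r. h * 1)"
      unfolding abs_mult using x that by (intro sum_mono mult_mono) auto
    finally show "L2_set (\<lambda>j. \<Sum>l<r. V (j, l) * x l) {..<d} \<le> real d * real r * h" by simp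
  qed
qed simp

definition factored :: "nat \<Rightarrow> (nat \<times> nat \<Rightarrow> real) \<Rightarrow> (nat \<times> nat \<Rightarrow> real) \<Rightarrow> nat \<times> nat \<Rightarrow> real" where
  "factored r W V = (\<lambda>(i, j). \<Sum>l<r. W (i, l) * V (j, l))"

text \<open>
  Each row of \<open>W V\<^sup>T\<close> is the image under \<open>V\<close> of the corresponding row of \<open>W\<close>.
\<close>
lemma L2_set_factored_le:
  "L2_set (factored r W V) ({..<m} \<times> {..<d}) \<le>
    operator_norm d r V * L2_set W ({..<m} \<times> {..<r})"
proof -
  have "L2_set (factored r W V) ({..<m} \<times> {..<d}) \<le>
      L2_set (\<lambda>i. operator_norm d r V * L2_set (\<lambda>l. W (i, l)) {..<r}) {..<m}"
    unfolding L2_set_product factored_def prod.case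
  proof (rule L2_set_mono)
    fix i
    show "L2_set (\<lambda>j. \<Sum>l<r. W (i, l) * V (j, l)) {..<d} \<le>
        operator_norm d r V * L2_set (\<lambda>l. W (i, l)) {..<r}"
      using L2_set_le_operator_norm[where V = V and x = "\<lambda>l. W (i, l)" and d = d and r = r] by (simp add: mult.commute)
  qed simp
  also have "\<dots> = operator_norm d r V * L2_set W ({..<m} \<times> {..<r})"
    unfolding L2_set_scale L2_set_product
    using coordinate_norm.nonneg[OF operator_norm_coordinate_norm, of d r V] by simp
  finally show ?thesis .
qed

text \<open>
  A set of matrices in the Frobenius unit ball that determines, up to the factor \<open>4\<close>, the size of
  a linear form \<open>G\<close> on all products \<open>W V\<^sup>T\<close>.
\<close>
definition norming_set :: "nat \<Rightarrow> nat \<Rightarrow> nat \<Rightarrow> (nat \<times> nat \<Rightarrow> real) set \<Rightarrow> bool" where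
  "norming_set m d r N \<longleftrightarrow>
    (\<forall>x\<in>N. L2_set x ({..<m} \<times> {..<d}) \<le> 1) \<and>
    (\<forall>G b. (\<forall>x\<in>N. \<bar>\<Sum>q\<in>{..<m} \<times> {..<d}. G q * x q\<bar> \<le> b) \<longrightarrow>
      (\<forall>W V. \<bar>\<Sum>q\<in>{..<m} \<times> {..<d}. G q * factored r W V q\<bar> \<le>
        4 * b * L2_set W ({..<m} \<times> {..<r}) * operator_norm d r V))"

lemma norming_setD:
  assumes "norming_set m d r N" "\<And>x. x \<in> N \<Longrightarrow> \<bar>\<Sum>q\<in>{..<m} \<times> {..<d}. G q * x q\<bar> \<le> b"
  shows "\<bar>\<Sum>q\<in>{..<m} \<times> {..<d}. G q * factored r W V q\<bar> \<le>
    4 * b * L2_set W ({..<m} \<times> {..<r}) * operator_norm d r V"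
  using assms unfolding norming_set_def by simp

text \<open>
  The value of \<open>G\<close> is linear in each factor, so a net for each factor loses a factor of \<open>2\<close>. It is
  essential that \<open>V\<close> is measured in the operator norm: a matrix with \<open>r\<close> orthonormal columns then
  belongs to the unit ball, whereas its Frobenius norm is \<open>\<surd>r\<close>.
\<close>
lemma exists_norming_set:
  "\<exists>N. finite N \<and> card N \<le> 7 ^ (r * (m + d)) \<and> norming_set m d r N"
proof -
  define I J where "I = {..<m} \<times> {..<r}" and "J = {..<d} \<times> {..<r}"
  interpret W: coordinate_norm I "\<lambda>x. L2_set x I" "real (card I)"
    by (rule L2_set_coordinate_norm) (simp add: I_def)
  interpret V: coordinate_norm J "operator_norm d r" "real d * real r"
    unfolding J_def by (rule operator_norm_coordinate_norm)
  obtain NW where NW: "finite NW" "card NW \<le> 7 ^ card I" "half_net (\<lambda>x. L2_set x I) NW"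
    using W.ball_net by auto
  obtain NV where NV: "finite NV" "card NV \<le> 7 ^ card J" "half_net (operator_norm d r) NV"
    using V.ball_net by auto
  define N where "N = (\<lambda>(W, V). factored r W V) ` (NW \<times> NV)"
  have "card N \<le> card (NW \<times> NV)"
    unfolding N_def by (rule card_image_le) (simp add: NW NV)
  also have "\<dots> \<le> 7 ^ card I * 7 ^ card J"
    unfolding card_cartesian_product using NW(2) NV(2) by (rule mult_mono) auto
  also have "\<dots> = 7 ^ (r * (m + d))"
    by (simp add: I_def J_def power_add[symmetric] algebra_simps)
  finally have "card N \<le> 7 ^ (r * (m + d))" .
  moreover have "finite N" by (simp add: N_def NW NV)
  moreover have "L2_set x ({..<m} \<times> {..<d}) \<le> 1" if x: "x \<in> N" for x
  proof -
    obtain W V where x: "x = factored r W V" "W \<in> NW" "V \<in> NV" using x by (auto simp: N_def)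
    have "operator_norm d r V * L2_set W I \<le> 1 * 1"
      using NW(3) NV(3) x by (intro mult_mono) (auto simp: half_net_def)
    then show ?thesis
      using L2_set_factored_le[of r W V m d] x by (simp add: I_def)
  qed
  moreover have "\<bar>\<Sum>q\<in>{..<m} \<times> {..<d}. G q * factored r W V q\<bar> \<le>
      4 * b * L2_set W I * operator_norm d r V"
    if G: "\<And>x. x \<in> N \<Longrightarrow> \<bar>\<Sum>q\<in>{..<m} \<times> {..<d}. G q * x q\<bar> \<le> b" for G b W V
  proof -
    define F where "F = (\<lambda>W V. \<Sum>q\<in>{..<m} \<times> {..<d}. G q * factored r W V q)"
    have F_W: "F W V = (\<Sum>q\<in>I. (\<Sum>j<d. G (fst q, j) * V (j, snd q)) * W q)" for W V
    proof -
      have "F W V = (\<Sum>i<m. \<Sum>j<d. \<Sum>l<r. G (i, j) * (W (i, l) * V (j, l)))"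
        by (simp add: F_def factored_def sum_Times sum_distrib_left)
      also have "\<dots> = (\<Sum>i<m. \<Sum>l<r. \<Sum>j<d. G (i, j) * (W (i, l) * V (j, l)))"
        by (intro sum.cong refl sum.swap)
      also have "\<dots> = (\<Sum>q\<in>I. (\<Sum>j<d. G (fst q, j) * V (j, snd q)) * W q)"
        by (simp add: I_def sum_Times sum_distrib_right mult.assoc mult.commute[of "V _"])
      finally show ?thesis .
    qed
    have F_V: "F W V = (\<Sum>q\<in>J. (\<Sum>i<m. G (i, fst q) * W (i, snd q)) * V q)" for W V
    proof -
      have "F W V = (\<Sum>i<m. \<Sum>j<d. \<Sum>l<r. G (i, j) * (W (i, l) * V (j, l)))"
        by (simp add: F_def factored_def sum_Times sum_distrib_left)
      also have "\<dots> = (\<Sum>j<d. \<Sum>l<r. \<Sum>i<m. G (i, j) * (W (i, l) * V (j, l)))"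
        by (rule trans[OF sum.swap]) (intro sum.cong refl sum.swap)
      also have "\<dots> = (\<Sum>q\<in>J. (\<Sum>i<m. G (i, fst q) * W (i, snd q)) * V q)"
        by (simp add: J_def sum_Times sum_distrib_right mult.assoc)
      finally show ?thesis .
    qed
    have 1: "\<bar>F W V\<bar> \<le> 2 * b * L2_set W I" if "V \<in> NV" for W V
    proof -
      have "\<bar>F W' V\<bar> \<le> b" if "W' \<in> NW" for W'
        unfolding F_def using that \<open>V \<in> NV\<close> by (intro G) (auto simp: N_def)
      then show ?thesis
        unfolding F_W by (rule W.linear_form_net_bound[OF NW(3)])
    qed
    have "\<bar>F W V\<bar> \<le> 2 * (2 * b * L2_set W I) * operator_norm d r V"
      using 1 unfolding F_V by (rule V.linear_form_net_bound[OF NV(3)])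
    then show ?thesis by (simp add: F_def)
  qed
  ultimately show ?thesis
    unfolding I_def norming_set_def by (intro exI[of _ N] conjI ballI allI impI) auto
qed

section \<open>Decomposition into low-rank blocks\<close>

text \<open>
  The number \<open>a\<close> bounds the total weight of a decomposition of \<open>x\<close> into products \<open>W V\<^sup>T\<close>, where the
  weight of a product is the Frobenius norm of \<open>W\<close> if \<open>V\<close> is a contraction. The least such \<open>a\<close> is
  the atomic norm generated by the matrices of rank at most \<open>r\<close> in the Frobenius unit ball.
\<close>
inductive factored_sum :: "nat \<Rightarrow> nat \<Rightarrow> nat \<Rightarrow> real \<Rightarrow> (nat \<times> nat \<Rightarrow> real) \<Rightarrow> bool"
  for m d r where
  atom: "L2_set W ({..<m} \<times> {..<r}) \<le> a \<Longrightarrow> operator_norm d r V \<le> 1 \<Longrightarrow>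
    factored_sum m d r a (factored r W V)"
| add: "factored_sum m d r a x \<Longrightarrow> factored_sum m d r b y \<Longrightarrow>
    factored_sum m d r (a + b) (\<lambda>q. x q + y q)"

lemma factored_sum_mono:
  "factored_sum m d r a x \<Longrightarrow> a \<le> b \<Longrightarrow> factored_sum m d r b x"
proof (induction arbitrary: b rule: factored_sum.induct)
  case (atom W a V)
  then show ?case by (intro factored_sum.atom) auto
next
  case (add a x c y)
  have "factored_sum m d r ((b - c) + c) (\<lambda>q. x q + y q)"
    using add.IH(1)[of "b - c"] add.prems add.hyps(2) by (intro factored_sum.add) auto
  then show ?case by simp
qed

lemma factored_sum_uminus:
  "factored_sum m d r a x \<Longrightarrow> factored_sum m d r a (\<lambda>q. - x q)"
proof (induction rule: factored_sum.induct)
  case (atom W a V)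
  have "factored_sum m d r a (factored r (\<lambda>q. - W q) V)"
    using atom by (intro factored_sum.atom) (simp_all add: L2_set_def)
  also have "factored r (\<lambda>q. - W q) V = (\<lambda>q. - factored r W V q)"
    by (auto simp: factored_def sum_negf)
  finally show ?case .
next
  case (add a x b y)
  then show ?case
    using factored_sum.add[of m d r a "\<lambda>q. - x q" b "\<lambda>q. - y q"] by simp
qed

lemma factored_sum_form_bound:
  assumes "factored_sum m d r a x" "0 \<le> c"
    and "\<And>W V. \<bar>\<Sum>q\<in>I. G q * factored r W V q\<bar> \<le>
      c * L2_set W ({..<m} \<times> {..<r}) * operator_norm d r V"
  shows "\<bar>\<Sum>q\<in>I. G q * x q\<bar> \<le> c * a"
  using assms(1)
proof (induction rule: factored_sum.induct)
  case (atom W a V)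
  have "c * L2_set W ({..<m} \<times> {..<r}) * operator_norm d r V \<le> c * a * 1"
    using atom assms(2) order_trans[OF L2_set_nonneg atom(1)]
      coordinate_norm.nonneg[OF operator_norm_coordinate_norm]
    by (intro mult_mono) auto
  then show ?case using assms(3)[of W V] by simp
next
  case (add a x b y)
  have "(\<Sum>q\<in>I. G q * (x q + y q)) = (\<Sum>q\<in>I. G q * x q) + (\<Sum>q\<in>I. G q * y q)"
    by (simp add: distrib_left sum.distrib)
  then show ?case using add.IH by (simp add: distrib_left)
qed

lemma orthonormal_combination:
  fixes c :: nat
  assumes v: "orthonormal d d v" and f: "inj_on f {..<c}" "f ` {..<c} \<subseteq> {..<d}"
  shows "(\<Sum>j<d. (\<Sum>l<c. v (f l) j * x l)\<^sup>2) = (\<Sum>l<c. (x l)\<^sup>2)"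
proof -
  have "(\<Sum>j<d. (\<Sum>l<c. v (f l) j * x l)\<^sup>2) =
      (\<Sum>j<d. \<Sum>l<c. \<Sum>k<c. x l * x k * (v (f l) j * v (f k) j))"
    by (simp add: power2_eq_square sum_product mult_ac)
  also have "\<dots> = (\<Sum>l<c. \<Sum>k<c. \<Sum>j<d. x l * x k * (v (f l) j * v (f k) j))"
    by (rule trans[OF sum.swap]) (intro sum.cong refl sum.swap)
  also have "\<dots> = (\<Sum>l<c. \<Sum>k<c. if l = k then x l * x k else 0)"
  proof (intro sum.cong refl)
    fix l k assume lk: "l \<in> {..<c}" "k \<in> {..<c}"
    have "(\<Sum>j<d. x l * x k * (v (f l) j * v (f k) j)) = x l * x k * dot d (v (f l)) (v (f k))"
      by (simp add: dot_def sum_distrib_left)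
    also have "dot d (v (f l)) (v (f k)) = (if l = k then 1 else 0)"
      using v f lk by (auto simp: orthonormal_def inj_on_def image_subset_iff)
    finally show "(\<Sum>j<d. x l * x k * (v (f l) j * v (f k) j)) = (if l = k then x l * x k else 0)"
      by simp
  qed
  also have "\<dots> = (\<Sum>l<c. (x l)\<^sup>2)"
    by (intro sum.cong refl) (simp add: power2_eq_square)
  finally show ?thesis .
qed

text \<open>
  The columns of \<open>V\<close> are the vectors \<open>v l\<close> for \<open>l \<in> T\<close>, padded by zero columns; orthonormality of
  these vectors makes \<open>V\<close> a contraction.
\<close>
lemma factored_sum_block:
  assumes v: "orthonormal d d v" and T: "T \<subseteq> {..<d}" "card T \<le> r"
    and a: "(\<Sum>l\<in>T. dot m (w l) (w l)) \<le> a\<^sup>2" "0 \<le> a"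
  shows "factored_sum m d r a (\<lambda>(i, j). \<Sum>l\<in>T. w l i * v l j)"
proof -
  define c where "c = card T"
  have "finite T" using T finite_subset by blast
  then obtain f where f: "bij_betw f {..<c} T"
    using ex_bij_betw_nat_finite[of T] unfolding c_def atLeast0LessThan by blast
  define W where "W = (\<lambda>(i, l). if l < c then w (f l) i else 0)"
  define V where "V = (\<lambda>(j, l). if l < c then v (f l) j else 0)"
  have trunc: "(\<Sum>l<r. if l < c then g l else 0) = (\<Sum>l<c. g l)" for g :: "nat \<Rightarrow> real"
  proof -
    have "{..<r} \<inter> {l. l < c} = {..<c}" using T(2) by (auto simp: c_def)
    then show ?thesis by (simp add: sum.If_cases)
  qed
  have "factored r W V = (\<lambda>(i, j). \<Sum>l\<in>T. w l i * v l j)"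
  proof (intro ext, clarify)
    fix i j
    have "factored r W V (i, j) = (\<Sum>l<r. if l < c then w (f l) i * v (f l) j else 0)"
      by (auto simp: factored_def W_def V_def intro: sum.cong)
    also have "\<dots> = (\<Sum>l<c. w (f l) i * v (f l) j)" by (rule trunc)
    also have "\<dots> = (\<Sum>l\<in>T. w l i * v l j)" by (rule sum.reindex_bij_betw[OF f])
    finally show "factored r W V (i, j) = (\<Sum>l\<in>T. w l i * v l j)" .
  qed
  moreover have "L2_set W ({..<m} \<times> {..<r}) \<le> a"
  proof -
    have "(\<Sum>q\<in>{..<m} \<times> {..<r}. (W q)\<^sup>2) = (\<Sum>i<m. \<Sum>l<r. if l < c then (w (f l) i)\<^sup>2 else 0)"
      unfolding sum_Times by (intro sum.cong) (auto simp: W_def)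
    also have "\<dots> = (\<Sum>l<c. \<Sum>i<m. (w (f l) i)\<^sup>2)"
      unfolding trunc by (rule sum.swap)
    also have "\<dots> = (\<Sum>l<c. dot m (w (f l)) (w (f l)))"
      by (simp add: dot_def power2_eq_square)
    also have "\<dots> = (\<Sum>l\<in>T. dot m (w l) (w l))" by (rule sum.reindex_bij_betw[OF f])
    finally show ?thesis
      using a by (simp add: L2_set_def real_le_lsqrt sum_nonneg)
  qed
  moreover have "operator_norm d r V \<le> 1"
  proof (rule operator_norm_least)
    fix x :: "nat \<Rightarrow> real" assume x: "L2_set x {..<r} \<le> 1"
    have "(\<Sum>l<r. V (j, l) * x l) = (\<Sum>l<c. v (f l) j * x l)" for j
      unfolding trunc[symmetric] by (intro sum.cong) (auto simp: V_def)
    then have "L2_set (\<lambda>j. \<Sum>l<r. V (j, l) * x l) {..<d} = L2_set x {..<c}"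
      using orthonormal_combination[OF v, of f c x] f T(1)
      by (simp add: L2_set_def bij_betw_def)
    also have "\<dots> \<le> L2_set x {..<r}"
      unfolding L2_set_def using T(2) by (intro real_sqrt_le_mono sum_mono2) (auto simp: c_def)
    finally show "L2_set (\<lambda>j. \<Sum>l<r. V (j, l) * x l) {..<d} \<le> 1" using x by simp
  qed
  ultimately show ?thesis using factored_sum.atom[of W m r a d V] by simp
qed

lemma exists_largest_entries:
  fixes s :: "'b \<Rightarrow> real"
  assumes "finite J" "k \<le> card J"
  shows "\<exists>T\<subseteq>J. card T = k \<and> (\<forall>t\<in>T. \<forall>l\<in>J - T. s l \<le> s t)"
  using assms(2)
proof (induction k)
  case 0
  then show ?case by (intro exI[of _ "{}"]) auto
next
  case (Suc k)
  then obtain T where T: "T \<subseteq> J" "card T = k" "\<forall>t\<in>T. \<forall>l\<in>J - T. s l \<le> s t" by auto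
  have "finite T" using T(1) assms(1) finite_subset by blast
  have "J - T \<noteq> {}" using T(1,2) Suc.prems by auto
  then obtain l where l: "l \<in> J - T" "\<And>l'. l' \<in> J - T \<Longrightarrow> s l' \<le> s l"
    using obtains_MAX[of "J - T" s] Max_ge[of "s ` (J - T)"] assms(1)
    by (metis finite_Diff finite_imageI imageI)
  then show ?case
    using T \<open>finite T\<close> by (intro exI[of _ "insert l T"]) auto
qed

text \<open>
  The \<open>r\<close> largest singular values in \<open>J\<close> are split off as one block of Frobenius norm at most
  \<open>\<surd>r \<mu>\<close>. All remaining values are at most the mean \<open>\<nu>\<close> of this block, so \<open>\<surd>r \<nu>\<close>, the bound for
  the next block, is paid for by the part of the nuclear norm that lies in the block split off.
\<close>
lemma factored_sum_blocks:
  assumes v: "orthonormal d d v" and r: "0 < r" and J: "J \<subseteq> {..<d}" and "0 \<le> \<mu>"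
    and "\<And>l. l \<in> J \<Longrightarrow> sqrt (dot m (w l) (w l)) \<le> \<mu>"
  shows "factored_sum m d r (sqrt r * \<mu> + (\<Sum>l\<in>J. sqrt (dot m (w l) (w l))) / sqrt r)
    (\<lambda>(i, j). \<Sum>l\<in>J. w l i * v l j)"
  using J assms(4,5)
proof (induction "card J" arbitrary: J \<mu> rule: less_induct)
  case less
  define s where "s = (\<lambda>l. sqrt (dot m (w l) (w l)))"
  have s: "0 \<le> s l" "dot m (w l) (w l) = (s l)\<^sup>2" for l
    by (simp_all add: s_def dot_self_nonneg)
  have bound: "s l \<le> \<mu>" if "l \<in> J" for l using less.prems(3)[OF that] by (simp add: s_def)
  have "finite J" using less.prems finite_subset by blast
  have block: "(\<Sum>l\<in>T. dot m (w l) (w l)) \<le> (sqrt r * \<mu>)\<^sup>2" if "T \<subseteq> J" "card T \<le> r" for T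
  proof -
    have "(\<Sum>l\<in>T. dot m (w l) (w l)) \<le> (\<Sum>l\<in>T. \<mu>\<^sup>2)"
      unfolding s(2) using bound s(1) that by (intro sum_mono power_mono) auto
    also have "\<dots> \<le> real r * \<mu>\<^sup>2" using that by (simp add: mult_right_mono)
    finally show ?thesis by (simp add: power_mult_distrib)
  qed
  show ?case
  proof (cases "card J \<le> r")
    case True
    have "factored_sum m d r (sqrt r * \<mu>) (\<lambda>(i, j). \<Sum>l\<in>J. w l i * v l j)"
      using True less.prems by (intro factored_sum_block[OF v] block) auto
    then show ?thesis
      by (rule factored_sum_mono) (simp add: sum_nonneg dot_self_nonneg)
  next
    case False
    then have "\<exists>T\<subseteq>J. card T = r \<and> (\<forall>t\<in>T. \<forall>l\<in>J - T. s l \<le> s t)"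
      using \<open>finite J\<close> by (intro exists_largest_entries) auto
    then obtain T where T: "T \<subseteq> J" "card T = r" "\<And>t l. t \<in> T \<Longrightarrow> l \<in> J - T \<Longrightarrow> s l \<le> s t"
      by blast
    have "finite T" using T(1) \<open>finite J\<close> finite_subset by blast
    define \<nu> where "\<nu> = (\<Sum>t\<in>T. s t) / r"
    have "s l \<le> \<nu>" if "l \<in> J - T" for l
      using sum_bounded_below[of T "s l" s] T(2) T(3)[OF _ that] r by (simp add: \<nu>_def field_simps)
    moreover have "0 \<le> \<nu>" by (simp add: \<nu>_def sum_nonneg s(1))
    moreover have "card (J - T) < card J"
      using T(1,2) r \<open>finite J\<close> \<open>finite T\<close> card_mono[of J T] by (simp add: card_Diff_subset)
    ultimately have "factored_sum m d r (sqrt r * \<nu> + (\<Sum>l\<in>J - T. s l) / sqrt r)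
        (\<lambda>(i, j). \<Sum>l\<in>J - T. w l i * v l j)"
      using less.hyps[of "J - T" \<nu>] less.prems(1) unfolding s_def by blast
    moreover have "factored_sum m d r (sqrt r * \<mu>) (\<lambda>(i, j). \<Sum>l\<in>T. w l i * v l j)"
      using T less.prems by (intro factored_sum_block[OF v] block) auto
    ultimately have "factored_sum m d r
        (sqrt r * \<mu> + (sqrt r * \<nu> + (\<Sum>l\<in>J - T. s l) / sqrt r))
        (\<lambda>q. (\<lambda>(i, j). \<Sum>l\<in>T. w l i * v l j) q + (\<lambda>(i, j). \<Sum>l\<in>J - T. w l i * v l j) q)"
      by (intro factored_sum.add)
    moreover have "(\<lambda>q. (\<lambda>(i, j). \<Sum>l\<in>T. w l i * v l j) q +
        (\<lambda>(i, j). \<Sum>l\<in>J - T. w l i * v l j) q) = (\<lambda>(i, j). \<Sum>l\<in>J. w l i * v l j)"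
      using T(1) \<open>finite J\<close> by (auto simp: sum.subset_diff)
    moreover have "sqrt r * \<nu> = (\<Sum>t\<in>T. s t) / sqrt r"
      using r by (simp add: \<nu>_def field_simps)
    moreover have "(\<Sum>t\<in>T. s t) / sqrt r + (\<Sum>l\<in>J - T. s l) / sqrt r = (\<Sum>l\<in>J. s l) / sqrt r"
      using T(1) \<open>finite J\<close> by (simp add: sum.subset_diff[of T J] add_divide_distrib add.commute)
    ultimately show ?thesis by (simp add: s_def)
  qed
qed

text \<open>
  The singular values above \<open>\<alpha> / \<surd>r\<close> are at most \<open>r\<close> in number and form one block, of weight at most
  the Frobenius norm. The others are treated by \<open>factored_sum_blocks\<close> with \<open>\<mu> = \<alpha> / \<surd>r\<close>.
\<close>
lemma factored_sum_of_norm_bounds: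
  assumes A: "A \<in> carrier_mat m d" and r: "0 < r" and \<alpha>: "0 < \<alpha>"
    and F: "frobenius_norm A \<le> \<alpha>" and nuc: "nuclear_norm A \<le> sqrt r * \<alpha>"
  shows "\<exists>x. factored_sum m d r (3 * \<alpha>) x \<and> (\<forall>i<m. \<forall>j<d. A $$ (i, j) = x (i, j))"
proof -
  obtain w v where v: "orthonormal d d v"
    and entries: "\<And>i j. i < m \<Longrightarrow> j < d \<Longrightarrow> A $$ (i, j) = (\<Sum>l<d. w l i * v l j)"
    and nuclear: "(\<Sum>l<d. sqrt (dot m (w l) (w l))) = nuclear_norm A"
    and frob: "(\<Sum>l<d. dot m (w l) (w l)) = (frobenius_norm A)\<^sup>2"
    using singular_value_decomposition[OF A] by blast
  define s where "s = (\<lambda>l. sqrt (dot m (w l) (w l)))"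
  have s: "0 \<le> s l" for l by (simp add: s_def dot_self_nonneg)
  define L where "L = {l. l < d \<and> \<alpha> / sqrt r < s l}"
  define S where "S = {..<d} - L"
  have L: "L \<subseteq> {..<d}" "finite L" by (auto simp: L_def)
  have sum_s: "(\<Sum>l\<in>J. s l) \<le> sqrt r * \<alpha>" if "J \<subseteq> {..<d}" for J
    using sum_mono2[OF _ that, of s] s nuclear nuc by (simp add: s_def)
  have "real (card L) * (\<alpha> / sqrt r) \<le> sqrt r * \<alpha>"
    using sum_bounded_below[of L "\<alpha> / sqrt r" s] sum_s[OF L(1)] by (force simp: L_def)
  then have "real (card L) * \<alpha> \<le> real r * \<alpha>"
    using r by (simp add: field_simps)
  then have "card L \<le> r" using \<alpha> by simp
  have "frobenius_norm A \<ge> 0" by (simp add: frobenius_norm_def sum_nonneg)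
  have "(\<Sum>l\<in>L. dot m (w l) (w l)) \<le> (frobenius_norm A)\<^sup>2"
    unfolding frob[symmetric] using L by (intro sum_mono2) (auto simp: dot_self_nonneg)
  also have "\<dots> \<le> \<alpha>\<^sup>2" using F \<open>frobenius_norm A \<ge> 0\<close> by (rule power_mono)
  finally have "factored_sum m d r \<alpha> (\<lambda>(i, j). \<Sum>l\<in>L. w l i * v l j)"
    using \<alpha> by (intro factored_sum_block[OF v L(1) \<open>card L \<le> r\<close>]) auto
  moreover have "factored_sum m d r (sqrt r * (\<alpha> / sqrt r) + (\<Sum>l\<in>S. s l) / sqrt r)
      (\<lambda>(i, j). \<Sum>l\<in>S. w l i * v l j)"
    unfolding s_def by (rule factored_sum_blocks[OF v r])
      (use \<alpha> in \<open>auto simp: S_def L_def s_def\<close>)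
  then have "factored_sum m d r (2 * \<alpha>) (\<lambda>(i, j). \<Sum>l\<in>S. w l i * v l j)"
    by (rule factored_sum_mono) (use sum_s[of S] r in \<open>simp add: S_def field_simps\<close>)
  ultimately have "factored_sum m d r (\<alpha> + 2 * \<alpha>)
      (\<lambda>q. (\<lambda>(i, j). \<Sum>l\<in>L. w l i * v l j) q + (\<lambda>(i, j). \<Sum>l\<in>S. w l i * v l j) q)"
    by (rule factored_sum.add)
  moreover have "A $$ (i, j) = (\<Sum>l\<in>L. w l i * v l j) + (\<Sum>l\<in>S. w l i * v l j)"
    if "i < m" "j < d" for i j
    unfolding entries[OF that] S_def using L by (simp add: sum.subset_diff[of L "{..<d}"])
  ultimately show ?thesis by (intro exI) auto
qed

section \<open>Gaussian quadratic forms\<close>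

lemma nn_integral_centered_normal:
  assumes [measurable]: "f \<in> borel_measurable borel"
  shows "(\<integral>\<^sup>+x. f x \<partial>centered_normal \<sigma>) = (\<integral>\<^sup>+x. ennreal (normal_density 0 \<sigma> x) * f x \<partial>lborel)"
  unfolding centered_normal_def by (subst nn_integral_density) auto

lemma nn_integral_centered_normal_scale:
  assumes [measurable]: "f \<in> borel_measurable borel" and a: "a \<noteq> 0"
  shows "(\<integral>\<^sup>+x. f x \<partial>centered_normal \<bar>a\<bar>) = (\<integral>\<^sup>+x. f (a * x) \<partial>centered_normal 1)"
proof -
  have density: "ennreal \<bar>a\<bar> * ennreal (normal_density 0 \<bar>a\<bar> (a * x)) = ennreal (normal_density 0 1 x)"
    for x
    using a by (simp add: ennreal_mult[symmetric] normal_density_def real_sqrt_mult power_mult_distrib)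
  have "(\<integral>\<^sup>+x. f x \<partial>centered_normal \<bar>a\<bar>) =
      (\<integral>\<^sup>+x. ennreal (normal_density 0 \<bar>a\<bar> x) * f x \<partial>lborel)"
    by (rule nn_integral_centered_normal) simp
  also have "\<dots> = \<bar>a\<bar> * (\<integral>\<^sup>+x. ennreal (normal_density 0 \<bar>a\<bar> (0 + a * x)) * f (0 + a * x) \<partial>lborel)"
    by (rule nn_integral_real_affine) (use a in auto)
  also have "\<dots> = (\<integral>\<^sup>+x. ennreal (normal_density 0 1 x) * f (a * x) \<partial>lborel)"
    by (subst nn_integral_cmult[symmetric]) (simp_all add: density mult.assoc[symmetric])
  also have "\<dots> = (\<integral>\<^sup>+x. f (a * x) \<partial>centered_normal 1)"
    by (rule nn_integral_centered_normal[symmetric]) simp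
  finally show ?thesis .
qed

text \<open>
  Stability of the normal distribution. Vanishing coefficients are included, so that arbitrary
  linear forms can be treated by induction although a point mass has no density.
\<close>
lemma nn_integral_centered_normal_add:
  assumes f[measurable]: "f \<in> borel_measurable borel"
  shows "(\<integral>\<^sup>+x. \<integral>\<^sup>+y. f (a * x + b * y) \<partial>centered_normal 1 \<partial>centered_normal 1) =
    (\<integral>\<^sup>+x. f (sqrt (a\<^sup>2 + b\<^sup>2) * x) \<partial>centered_normal 1)"
proof -
  interpret \<gamma>: prob_space "centered_normal 1" by (rule prob_space_centered_normal) simp
  have abs: "(\<integral>\<^sup>+x. f (c * x) \<partial>centered_normal 1) = (\<integral>\<^sup>+x. f (\<bar>c\<bar> * x) \<partial>centered_normal 1)" for c
    using nn_integral_centered_normal_scale[OF f, of c]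
      nn_integral_centered_normal_scale[OF f, of "\<bar>c\<bar>"]
    by (cases "c = 0") auto
  consider "a = 0" | "b = 0" | "a \<noteq> 0" "b \<noteq> 0" by blast
  then show ?thesis
  proof cases
    case 1
    then show ?thesis using abs[of b] by (simp add: \<gamma>.emeasure_space_1)
  next
    case 2
    then show ?thesis using abs[of a] by (simp add: \<gamma>.emeasure_space_1)
  next
    case 3
    define s where "s = sqrt (a\<^sup>2 + b\<^sup>2)"
    have s: "0 < s" unfolding s_def using 3 by (simp add: add_pos_pos)
    let ?n = "\<lambda>\<sigma> x. ennreal (normal_density 0 \<sigma> x)"
    have "(\<integral>\<^sup>+x. \<integral>\<^sup>+y. f (a * x + b * y) \<partial>centered_normal 1 \<partial>centered_normal 1) =
        (\<integral>\<^sup>+x. \<integral>\<^sup>+y. f (x + y) \<partial>centered_normal \<bar>b\<bar> \<partial>centered_normal \<bar>a\<bar>)"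
      using 3 by (simp add: nn_integral_centered_normal_scale)
    also have "\<dots> = (\<integral>\<^sup>+x. ?n \<bar>a\<bar> x * (\<integral>\<^sup>+y. ?n \<bar>b\<bar> y * f (x + y) \<partial>lborel) \<partial>lborel)"
      by (simp add: nn_integral_centered_normal)
    also have "\<dots> = (\<integral>\<^sup>+x. ?n \<bar>a\<bar> x * (\<integral>\<^sup>+y. ?n \<bar>b\<bar> (y - x) * f y \<partial>lborel) \<partial>lborel)"
    proof -
      have "(\<integral>\<^sup>+y. ?n \<bar>b\<bar> y * f (x + y) \<partial>lborel) = (\<integral>\<^sup>+y. ?n \<bar>b\<bar> (y - x) * f y \<partial>lborel)" for x
        using nn_integral_real_affine[of "\<lambda>y. ?n \<bar>b\<bar> (y - x) * f y" 1 x] by simp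
      then show ?thesis by (simp only:)
    qed
    also have "\<dots> = (\<integral>\<^sup>+x. \<integral>\<^sup>+y. (?n \<bar>b\<bar> (y - x) * ?n \<bar>a\<bar> x) * f y \<partial>lborel \<partial>lborel)"
      by (subst nn_integral_cmult[symmetric]) (simp_all add: mult_ac)
    also have "\<dots> = (\<integral>\<^sup>+y. \<integral>\<^sup>+x. (?n \<bar>b\<bar> (y - x) * ?n \<bar>a\<bar> x) * f y \<partial>lborel \<partial>lborel)"
      by (rule lborel_pair.Fubini') measurable
    also have "\<dots> = (\<integral>\<^sup>+y. (\<integral>\<^sup>+x. ennreal (normal_density 0 \<bar>b\<bar> (y - x) * normal_density 0 \<bar>a\<bar> x) \<partial>lborel) * f y \<partial>lborel)"
      by (subst nn_integral_multc[symmetric]) (simp_all add: ennreal_mult)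
    also have "\<dots> = (\<integral>\<^sup>+y. ?n s y * f y \<partial>lborel)"
      using fun_cong[OF conv_normal_density_zero_mean[of "\<bar>b\<bar>" "\<bar>a\<bar>"]] 3
      by (simp add: s_def add.commute)
    also have "\<dots> = (\<integral>\<^sup>+x. f (s * x) \<partial>centered_normal 1)"
      using nn_integral_centered_normal_scale[OF f, of s] s
      by (simp add: nn_integral_centered_normal)
    finally show ?thesis by (simp add: s_def)
  qed
qed

lemma nn_integral_gaussian_linear_form:
  assumes "finite I" and f[measurable]: "f \<in> borel_measurable borel"
  shows "(\<integral>\<^sup>+x. f (\<Sum>p\<in>I. a p * x p) \<partial>(\<Pi>\<^sub>M p\<in>I. centered_normal 1)) =
    (\<integral>\<^sup>+x. f (sqrt (\<Sum>p\<in>I. (a p)\<^sup>2) * x) \<partial>centered_normal 1)"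
  using assms
proof (induction I arbitrary: f rule: finite_induct)
  case empty
  interpret \<gamma>: prob_space "centered_normal 1" by (rule prob_space_centered_normal) simp
  interpret E: prob_space "\<Pi>\<^sub>M p\<in>{}. centered_normal 1"
    by (rule prob_space_PiM) simp
  show ?case by (simp add: \<gamma>.emeasure_space_1 E.emeasure_space_1)
next
  case (insert i I)
  note [measurable] = insert.prems
  interpret \<gamma>: prob_space "centered_normal 1" by (rule prob_space_centered_normal) simp
  interpret product_sigma_finite "\<lambda>_. centered_normal 1" by standard
  have "(\<integral>\<^sup>+x. f (\<Sum>p\<in>insert i I. a p * x p) \<partial>(\<Pi>\<^sub>M p\<in>insert i I. centered_normal 1)) =
      (\<integral>\<^sup>+x. \<integral>\<^sup>+y. f (\<Sum>p\<in>insert i I. a p * (x(i := y)) p) \<partial>centered_normal 1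
        \<partial>(\<Pi>\<^sub>M p\<in>I. centered_normal 1))"
    by (rule product_nn_integral_insert) (use insert.hyps in measurable)
  also have "\<dots> = (\<integral>\<^sup>+x. (\<lambda>u. \<integral>\<^sup>+y. f (1 * u + a i * y) \<partial>centered_normal 1) (\<Sum>p\<in>I. a p * x p)
        \<partial>(\<Pi>\<^sub>M p\<in>I. centered_normal 1))"
  proof -
    have "(\<Sum>p\<in>insert i I. a p * (x(i := y)) p) = 1 * (\<Sum>p\<in>I. a p * x p) + a i * y" for x y
    proof -
      have "(\<Sum>p\<in>I. a p * (x(i := y)) p) = (\<Sum>p\<in>I. a p * x p)"
        using insert.hyps by (intro sum.cong) auto
      then show ?thesis using insert.hyps by simp
    qed
    then show ?thesis by simp
  qed
  also have "\<dots> = (\<integral>\<^sup>+x. \<integral>\<^sup>+y. f (1 * (sqrt (\<Sum>p\<in>I. (a p)\<^sup>2) * x) + a i * y)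
      \<partial>centered_normal 1 \<partial>centered_normal 1)"
    by (rule insert.IH) measurable
  also have "\<dots> = (\<integral>\<^sup>+x. f (sqrt ((sqrt (\<Sum>p\<in>I. (a p)\<^sup>2))\<^sup>2 + (a i)\<^sup>2) * x) \<partial>centered_normal 1)"
    using nn_integral_centered_normal_add[OF insert.prems] by simp
  also have "(sqrt (\<Sum>p\<in>I. (a p)\<^sup>2))\<^sup>2 + (a i)\<^sup>2 = (\<Sum>p\<in>insert i I. (a p)\<^sup>2)"
    using insert.hyps by (simp add: sum_nonneg)
  finally show ?case .
qed

text \<open>
  The coefficient \<open>t / \<sigma>\<close> makes the noise a further standard normal coordinate, with coefficient \<open>t\<close>.
  Thus gram error and noise term are treated by one concentration inequality.
\<close>
definition response ::
    "nat \<Rightarrow> nat \<Rightarrow> real \<Rightarrow> (nat \<times> nat \<Rightarrow> real) \<Rightarrow> real \<Rightarrow>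
      (nat \<Rightarrow> nat \<times> nat \<Rightarrow> real) \<times> (nat \<Rightarrow> real) \<Rightarrow> nat \<Rightarrow> real" where
  "response d1 d2 \<sigma> x t \<omega> k =
    (\<Sum>p\<in>{..<d1} \<times> {..<d2}. x p * fst \<omega> k p) + t / \<sigma> * snd \<omega> k"

definition energy :: "nat \<Rightarrow> nat \<Rightarrow> (nat \<times> nat \<Rightarrow> real) \<Rightarrow> real \<Rightarrow> real" where
  "energy d1 d2 x t = (\<Sum>p\<in>{..<d1} \<times> {..<d2}. (x p)\<^sup>2) + t\<^sup>2"

lemma energy_nonneg: "0 \<le> energy d1 d2 x t"
  by (simp add: energy_def sum_nonneg)

lemma response_measurable [measurable]:
  assumes "k < n"
  shows "(\<lambda>\<omega>. response d1 d2 \<sigma> x t \<omega> k) \<in> borel_measurable (data_law d1 d2 n \<sigma>)"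
proof -
  have entry: "(\<lambda>A. A p) \<in> borel_measurable (gaussian_entries d1 d2)" if "p \<in> {..<d1} \<times> {..<d2}" for p
    using measurable_component_singleton[OF that, of "\<lambda>_. centered_normal 1"]
    by (simp add: gaussian_entries_def cong: measurable_cong_sets[OF refl sets_centered_normal])
  have "(\<lambda>\<omega>. fst \<omega> k) \<in> data_law d1 d2 n \<sigma> \<rightarrow>\<^sub>M gaussian_entries d1 d2"
    unfolding data_law_def using assms by simp
  from measurable_compose[OF this entry]
  have "(\<lambda>\<omega>. fst \<omega> k p) \<in> borel_measurable (data_law d1 d2 n \<sigma>)" if "p \<in> {..<d1} \<times> {..<d2}" for p
    using that .
  moreover have "(\<lambda>\<omega>. snd \<omega> k) \<in> data_law d1 d2 n \<sigma> \<rightarrow>\<^sub>M centered_normal \<sigma>"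
    unfolding data_law_def using assms by simp
  then have "(\<lambda>\<omega>. snd \<omega> k) \<in> borel_measurable (data_law d1 d2 n \<sigma>)"
    by (simp cong: measurable_cong_sets[OF refl sets_centered_normal])
  ultimately show ?thesis
    unfolding response_def by (intro borel_measurable_add borel_measurable_sum borel_measurable_times) auto
qed

text \<open>
  The responses to different \<open>k\<close> are independent normal variables with variance \<open>energy d1 d2 x t\<close>.
\<close>
lemma nn_integral_prod_response:
  assumes f[measurable]: "f \<in> borel_measurable borel" and \<sigma>: "0 < \<sigma>"
  shows "(\<integral>\<^sup>+\<omega>. (\<Prod>k<n. f (response d1 d2 \<sigma> x t \<omega> k)) \<partial>data_law d1 d2 n \<sigma>) =
    (\<integral>\<^sup>+g. f (sqrt (energy d1 d2 x t) * g) \<partial>centered_normal 1) ^ n"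
proof -
  interpret \<gamma>: prob_space "centered_normal 1" by (rule prob_space_centered_normal) simp
  interpret \<nu>: prob_space "centered_normal \<sigma>" by (rule prob_space_centered_normal) (rule \<sigma>)
  interpret G: prob_space "gaussian_entries d1 d2"
    unfolding gaussian_entries_def by (rule prob_space_PiM) (rule prob_space_centered_normal, simp)
  interpret PG: product_sigma_finite "\<lambda>_. gaussian_entries d1 d2" by standard
  interpret P\<nu>: product_sigma_finite "\<lambda>_. centered_normal \<sigma>" by standard
  interpret P: prob_space "\<Pi>\<^sub>M k\<in>{..<n}. centered_normal \<sigma>"
    by (rule prob_space_PiM) (rule prob_space_centered_normal, rule \<sigma>)
  define u where "u = (\<lambda>(A :: nat \<times> nat \<Rightarrow> real). \<Sum>p\<in>{..<d1} \<times> {..<d2}. x p * A p)"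
  have u[measurable]: "u \<in> borel_measurable (gaussian_entries d1 d2)"
    unfolding u_def by measurable
  define h where "h = (\<lambda>z. \<integral>\<^sup>+y. f (z + t / \<sigma> * y) \<partial>centered_normal \<sigma>)"
  have h[measurable]: "h \<in> borel_measurable borel"
    unfolding h_def by measurable
  have h_eq: "h z = (\<integral>\<^sup>+y. f (1 * z + t * y) \<partial>centered_normal 1)" for z
    using nn_integral_centered_normal_scale[of "\<lambda>y. f (z + t / \<sigma> * y)" \<sigma>] \<sigma> by (simp add: h_def)
  have "(\<integral>\<^sup>+\<omega>. (\<Prod>k<n. f (response d1 d2 \<sigma> x t \<omega> k)) \<partial>data_law d1 d2 n \<sigma>) =
      (\<integral>\<^sup>+A. \<integral>\<^sup>+\<eta>. (\<Prod>k<n. f (u (A k) + t / \<sigma> * \<eta> k)) \<partial>(\<Pi>\<^sub>M k\<in>{..<n}. centered_normal \<sigma>)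
        \<partial>(\<Pi>\<^sub>M k\<in>{..<n}. gaussian_entries d1 d2))"
  proof -
    have "(\<lambda>\<omega>. \<Prod>k<n. f (response d1 d2 \<sigma> x t \<omega> k)) \<in> borel_measurable (data_law d1 d2 n \<sigma>)"
      by (intro borel_measurable_prod_ennreal measurable_compose[OF response_measurable f]) simp
    then show ?thesis
      unfolding data_law_def
      by (subst P.nn_integral_fst[symmetric]) (simp_all only: response_def u_def fst_conv snd_conv)
  qed
  also have "\<dots> = (\<integral>\<^sup>+A. (\<Prod>k<n. h (u (A k))) \<partial>(\<Pi>\<^sub>M k\<in>{..<n}. gaussian_entries d1 d2))"
    unfolding h_def
    by (intro nn_integral_cong P\<nu>.product_nn_integral_prod[of _ "\<lambda>k y. f (u (_ k) + t / \<sigma> * y)"]) auto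
  also have "\<dots> = (\<Prod>k<n. \<integral>\<^sup>+A. h (u A) \<partial>gaussian_entries d1 d2)"
    by (rule PG.product_nn_integral_prod) auto
  also have "\<dots> = (\<integral>\<^sup>+A. h (u A) \<partial>gaussian_entries d1 d2) ^ n"
    by simp
  also have "(\<integral>\<^sup>+A. h (u A) \<partial>gaussian_entries d1 d2) =
      (\<integral>\<^sup>+g. h (sqrt (\<Sum>p\<in>{..<d1} \<times> {..<d2}. (x p)\<^sup>2) * g) \<partial>centered_normal 1)"
    unfolding u_def gaussian_entries_def by (rule nn_integral_gaussian_linear_form) auto
  also have "\<dots> = (\<integral>\<^sup>+g. \<integral>\<^sup>+y. f (sqrt (\<Sum>p\<in>{..<d1} \<times> {..<d2}. (x p)\<^sup>2) * g + t * y)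
      \<partial>centered_normal 1 \<partial>centered_normal 1)"
    by (simp add: h_eq)
  also have "\<dots> = (\<integral>\<^sup>+g. f (sqrt (energy d1 d2 x t) * g) \<partial>centered_normal 1)"
    by (subst nn_integral_centered_normal_add[OF f]) (simp add: energy_def sum_nonneg)
  finally show ?thesis .
qed

text \<open>
  The integral equals \<open>(1 - 2 \<theta>) powr (- 1 / 2)\<close>, since the integrand times the standard normal
  density is a multiple of the normal density with variance \<open>1 / (1 - 2 \<theta>)\<close>.
\<close>
lemma nn_integral_exp_square_le:
  fixes \<theta> :: real
  assumes \<theta>: "\<bar>\<theta>\<bar> \<le> 1 / 4"
  shows "(\<integral>\<^sup>+g. ennreal (exp (\<theta> * g\<^sup>2)) \<partial>centered_normal 1) \<le> ennreal (exp (\<theta> + 4 * \<theta>\<^sup>2))"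
proof -
  define v where "v = 1 - 2 * \<theta>"
  have v: "0 < v" using \<theta> by (auto simp: v_def abs_le_iff)
  define \<tau> where "\<tau> = 1 / sqrt v"
  have \<tau>: "0 < \<tau>" "\<tau>\<^sup>2 = 1 / v" using v by (simp_all add: \<tau>_def power_divide)
  interpret N: prob_space "centered_normal \<tau>" by (rule prob_space_centered_normal) (rule \<tau>)
  have density: "normal_density 0 1 x * exp (\<theta> * x\<^sup>2) = \<tau> * normal_density 0 \<tau> x" for x
  proof -
    have "- x\<^sup>2 / (2 * \<tau>\<^sup>2) = - (v * x\<^sup>2 / 2)"
      by (simp add: \<tau>(2))
    also have "\<dots> = - x\<^sup>2 / 2 + \<theta> * x\<^sup>2"
      by (simp add: v_def left_diff_distrib diff_divide_distrib)
    finally have "- x\<^sup>2 / 2 + \<theta> * x\<^sup>2 = - x\<^sup>2 / (2 * \<tau>\<^sup>2)" ..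
    then have "exp (- x\<^sup>2 / 2) * exp (\<theta> * x\<^sup>2) = exp (- x\<^sup>2 / (2 * \<tau>\<^sup>2))"
      by (simp add: exp_add[symmetric])
    then show ?thesis
      using \<tau>(1) by (simp add: normal_density_def real_sqrt_mult)
  qed
  have "(\<integral>\<^sup>+g. ennreal (exp (\<theta> * g\<^sup>2)) \<partial>centered_normal 1) =
      (\<integral>\<^sup>+g. ennreal \<tau> * ennreal (normal_density 0 \<tau> g) \<partial>lborel)"
    using \<tau>(1) by (subst nn_integral_centered_normal)
      (simp_all add: ennreal_mult[symmetric] density)
  also have "\<dots> = ennreal \<tau> * (\<integral>\<^sup>+g. 1 \<partial>centered_normal \<tau>)"
    by (subst nn_integral_centered_normal) (simp_all add: nn_integral_cmult)
  also have "\<dots> = ennreal \<tau>" by (simp add: N.emeasure_space_1)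
  also have "\<tau> = exp (- (ln v / 2))"
    using v by (simp add: \<tau>_def exp_minus ln_sqrt[symmetric] inverse_eq_divide)
  also have "- (ln v / 2) \<le> \<theta> + 4 * \<theta>\<^sup>2"
  proof -
    have "\<bar>- 2 * \<theta>\<bar> \<le> 1 / 2" using \<theta> by (simp add: abs_mult)
    from abs_ln_one_plus_x_minus_x_bound[OF this]
    have "\<bar>ln v + 2 * \<theta>\<bar> \<le> 8 * \<theta>\<^sup>2" by (simp add: v_def power_mult_distrib)
    then show ?thesis by linarith
  qed
  finally show ?thesis by simp
qed


definition deviation ::
    "nat \<Rightarrow> nat \<Rightarrow> nat \<Rightarrow> real \<Rightarrow> (nat \<times> nat \<Rightarrow> real) \<Rightarrow> real \<Rightarrow>
      (nat \<Rightarrow> nat \<times> nat \<Rightarrow> real) \<times> (nat \<Rightarrow> real) \<Rightarrow> real" where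
  "deviation d1 d2 n \<sigma> x t \<omega> =
    (\<Sum>k<n. (response d1 d2 \<sigma> x t \<omega> k)\<^sup>2) - real n * energy d1 d2 x t"

lemma deviation_measurable [measurable]:
  "deviation d1 d2 n \<sigma> x t \<in> borel_measurable (data_law d1 d2 n \<sigma>)"
  unfolding deviation_def[abs_def]
  by (intro borel_measurable_diff borel_measurable_sum borel_measurable_power response_measurable) auto

text \<open>
  Markov's inequality for the exponential of the deviation; the sign of \<open>\<theta>\<close> selects the upper or
  the lower tail.
\<close>
lemma chernoff_deviation:
  assumes \<sigma>: "0 < \<sigma>" and s: "0 < energy d1 d2 x t" and \<theta>: "\<bar>\<theta>\<bar> \<le> 1 / 4"
  shows "emeasure (data_law d1 d2 n \<sigma>) {\<omega> \<in> space (data_law d1 d2 n \<sigma>).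
      b * energy d1 d2 x t \<le> \<theta> * deviation d1 d2 n \<sigma> x t \<omega>} \<le>
    ennreal (exp (4 * real n * \<theta>\<^sup>2 - b))"
proof -
  let ?M = "data_law d1 d2 n \<sigma>"
  define s where "s = energy d1 d2 x t"
  have "0 < s" using assms by (simp add: s_def)
  define F where "F = (\<lambda>z. ennreal (exp (\<theta> / s * z\<^sup>2)))"
  define c where "c = exp (- \<theta> * real n - b)"
  have F[measurable]: "F \<in> borel_measurable borel" unfolding F_def by measurable
  have prod: "(\<Prod>k<n. F (response d1 d2 \<sigma> x t \<omega> k)) =
      ennreal (exp (\<theta> / s * (\<Sum>k<n. (response d1 d2 \<sigma> x t \<omega> k)\<^sup>2)))" for \<omega>
    by (simp add: F_def prod_ennreal exp_sum sum_distrib_left)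
  have meas: "(\<lambda>\<omega>. \<Prod>k<n. F (response d1 d2 \<sigma> x t \<omega> k)) \<in> borel_measurable ?M"
    by (intro borel_measurable_prod_ennreal measurable_compose[OF response_measurable F]) simp
  have "{\<omega> \<in> space ?M. b * s \<le> \<theta> * deviation d1 d2 n \<sigma> x t \<omega>} \<subseteq>
      {\<omega> \<in> space ?M. 1 \<le> ennreal c * (\<Prod>k<n. F (response d1 d2 \<sigma> x t \<omega> k))}"
  proof (intro Collect_mono impI conjI; elim conjE)
    fix \<omega> assume "b * s \<le> \<theta> * deviation d1 d2 n \<sigma> x t \<omega>"
    then have "b \<le> \<theta> * deviation d1 d2 n \<sigma> x t \<omega> / s"
      using \<open>0 < s\<close> by (simp add: field_simps)
    also have "\<dots> = \<theta> / s * (\<Sum>k<n. (response d1 d2 \<sigma> x t \<omega> k)\<^sup>2) - \<theta> * real n"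
      using \<open>0 < s\<close> by (simp add: deviation_def s_def[symmetric] field_simps)
    finally have "exp 0 \<le> exp (- \<theta> * real n - b + \<theta> / s * (\<Sum>k<n. (response d1 d2 \<sigma> x t \<omega> k)\<^sup>2))"
      by (subst exp_le_cancel_iff) simp
    then show "1 \<le> ennreal c * (\<Prod>k<n. F (response d1 d2 \<sigma> x t \<omega> k))"
      unfolding prod c_def by (simp add: exp_add[symmetric] ennreal_mult[symmetric] flip: ennreal_1)
  qed
  then have "emeasure ?M {\<omega> \<in> space ?M. b * s \<le> \<theta> * deviation d1 d2 n \<sigma> x t \<omega>} \<le>
      emeasure ?M {\<omega> \<in> space ?M. 1 \<le> ennreal c * (\<Prod>k<n. F (response d1 d2 \<sigma> x t \<omega> k))}"
    by (rule emeasure_mono) (use meas in measurable)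
  also have "\<dots> \<le> ennreal c * (\<integral>\<^sup>+\<omega>. (\<Prod>k<n. F (response d1 d2 \<sigma> x t \<omega> k)) * indicator (space ?M) \<omega> \<partial>?M)"
    by (rule nn_integral_Markov_inequality) (use meas in auto)
  also have "(\<integral>\<^sup>+\<omega>. (\<Prod>k<n. F (response d1 d2 \<sigma> x t \<omega> k)) * indicator (space ?M) \<omega> \<partial>?M) =
      (\<integral>\<^sup>+\<omega>. (\<Prod>k<n. F (response d1 d2 \<sigma> x t \<omega> k)) \<partial>?M)"
    by (intro nn_integral_cong) simp
  also have "\<dots> = (\<integral>\<^sup>+g. F (sqrt s * g) \<partial>centered_normal 1) ^ n"
    unfolding s_def by (rule nn_integral_prod_response[OF F \<sigma>])
  also have "\<dots> = (\<integral>\<^sup>+g. ennreal (exp (\<theta> * g\<^sup>2)) \<partial>centered_normal 1) ^ n"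
    using \<open>0 < s\<close> by (simp add: F_def power_mult_distrib)
  also have "\<dots> \<le> ennreal (exp (\<theta> + 4 * \<theta>\<^sup>2)) ^ n"
    by (intro power_mono nn_integral_exp_square_le \<theta>) simp
  also have "ennreal c * \<dots> = ennreal (exp (4 * real n * \<theta>\<^sup>2 - b))"
    by (simp add: c_def ennreal_power exp_of_nat_mult[symmetric] ennreal_mult[symmetric]
        exp_add[symmetric] algebra_simps)
  finally show ?thesis by (simp add: mult_left_mono s_def)
qed

text \<open>
  The exponent \<open>4 n \<theta>\<^sup>2 - n \<theta> \<delta>\<close> is optimized by \<open>\<theta> = \<delta> / 8\<close>, and the moment generating function
  limits the choice, whence \<open>\<theta> = min 1 \<delta> / 8\<close>.
\<close>
lemma deviation_tail:
  assumes \<sigma>: "0 < \<sigma>" and \<delta>: "0 \<le> \<delta>"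
  shows "measure (data_law d1 d2 n \<sigma>) {\<omega> \<in> space (data_law d1 d2 n \<sigma>).
      real n * \<delta> * energy d1 d2 x t < \<bar>deviation d1 d2 n \<sigma> x t \<omega>\<bar>} \<le>
    2 * exp (- (real n * min 1 \<delta> * \<delta> / 16))" (is "measure ?M ?B \<le> _")
proof (cases "energy d1 d2 x t = 0")
  case True
  then have "(\<Sum>p\<in>{..<d1} \<times> {..<d2}. (x p)\<^sup>2) = 0 \<and> t\<^sup>2 = 0"
    unfolding energy_def by (subst (asm) add_nonneg_eq_0_iff) (auto simp: sum_nonneg)
  then have "t = 0" "\<And>p. p \<in> {..<d1} \<times> {..<d2} \<Longrightarrow> x p = 0"
    by (auto simp: sum_nonneg_eq_0_iff)
  then have "response d1 d2 \<sigma> x t \<omega> k = 0" for \<omega> k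
    by (simp add: response_def)
  then have "?B = {}" using True by (simp add: deviation_def)
  then have "measure ?M ?B = 0" by (simp only: measure_empty)
  then show ?thesis by simp
next
  case False
  then have s: "0 < energy d1 d2 x t"
    using energy_nonneg[of d1 d2 x t] by linarith
  interpret prob_space ?M by (rule prob_space_data_law[OF \<sigma>])
  define \<theta> where "\<theta> = min 1 \<delta> / 8"
  have \<theta>: "0 \<le> \<theta>" "\<theta> \<le> 1 / 4" "\<theta> * 8 \<le> \<delta>" using \<delta> by (auto simp: \<theta>_def)
  define b where "b = real n * \<theta> * \<delta>"
  define B where "B = (\<lambda>\<theta>. {\<omega> \<in> space ?M. b * energy d1 d2 x t \<le> \<theta> * deviation d1 d2 n \<sigma> x t \<omega>})"
  have B: "B \<theta>' \<in> sets ?M" for \<theta>' unfolding B_def by measurable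
  have "4 * real n * \<theta>\<^sup>2 - b \<le> - (real n * min 1 \<delta> * \<delta> / 16)"
  proof -
    have "4 * real n * \<theta>\<^sup>2 = real n * \<theta> / 2 * (\<theta> * 8)"
      by (simp add: power2_eq_square)
    also have "\<dots> \<le> real n * \<theta> / 2 * \<delta>"
      using \<theta> by (intro mult_left_mono) auto
    also have "\<dots> = b / 2" by (simp add: b_def)
    finally have "4 * real n * \<theta>\<^sup>2 \<le> b / 2" .
    moreover have "real n * min 1 \<delta> * \<delta> / 16 = b / 2" by (simp add: b_def \<theta>_def)
    ultimately show ?thesis by linarith
  qed
  then have exp: "exp (4 * real n * \<theta>\<^sup>2 - b) \<le> exp (- (real n * min 1 \<delta> * \<delta> / 16))"
    by simp
  have tail: "measure ?M (B \<theta>') \<le> exp (- (real n * min 1 \<delta> * \<delta> / 16))" if "\<bar>\<theta>'\<bar> = \<theta>" for \<theta>'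
  proof -
    have "emeasure ?M (B \<theta>') \<le> ennreal (exp (4 * real n * \<theta>'\<^sup>2 - b))"
      unfolding B_def by (rule chernoff_deviation[OF \<sigma> s]) (use that \<theta> in simp)
    also have "\<theta>'\<^sup>2 = \<theta>\<^sup>2" using power2_abs[of \<theta>'] that by simp
    finally have "measure ?M (B \<theta>') \<le> exp (4 * real n * \<theta>\<^sup>2 - b)"
      by (simp add: emeasure_eq_measure)
    then show ?thesis using exp by linarith
  qed
  have "measure ?M (B \<theta>) + measure ?M (B (- \<theta>)) \<le> 2 * exp (- (real n * min 1 \<delta> * \<delta> / 16))"
    using tail[of \<theta>] tail[of "- \<theta>"] \<theta>(1) by linarith
  moreover have "?B \<subseteq> B \<theta> \<union> B (- \<theta>)"
  proof (intro subsetI)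
    fix \<omega> assume \<omega>: "\<omega> \<in> ?B"
    then have "\<theta> * (real n * \<delta> * energy d1 d2 x t) \<le> \<theta> * \<bar>deviation d1 d2 n \<sigma> x t \<omega>\<bar>"
      using \<theta> by (intro mult_left_mono) auto
    then show "\<omega> \<in> B \<theta> \<union> B (- \<theta>)"
      using \<omega> by (cases "0 \<le> deviation d1 d2 n \<sigma> x t \<omega>") (simp_all add: B_def b_def mult_ac)
  qed
  then have "measure ?M ?B \<le> measure ?M (B \<theta> \<union> B (- \<theta>))"
    by (intro finite_measure_mono) (use B in auto)
  moreover have "\<dots> \<le> measure ?M (B \<theta>) + measure ?M (B (- \<theta>))"
    by (rule measure_Un_le[OF B B])
  ultimately show ?thesis by linarith
qed

section \<open>Uniform deviation bounds\<close>

definition inner_on :: "nat \<Rightarrow> nat \<Rightarrow> (nat \<times> nat \<Rightarrow> real) \<Rightarrow> (nat \<times> nat \<Rightarrow> real) \<Rightarrow> real" where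
  "inner_on d1 d2 x y = (\<Sum>p\<in>{..<d1} \<times> {..<d2}. x p * y p)"

definition gram_error ::
    "nat \<Rightarrow> nat \<Rightarrow> nat \<Rightarrow> (nat \<Rightarrow> nat \<times> nat \<Rightarrow> real) \<Rightarrow>
      (nat \<times> nat \<Rightarrow> real) \<Rightarrow> (nat \<times> nat \<Rightarrow> real) \<Rightarrow> real" where
  "gram_error d1 d2 n A x y =
    (\<Sum>k<n. inner_on d1 d2 (A k) x * inner_on d1 d2 (A k) y) - real n * inner_on d1 d2 x y"

lemma inner_on_commute: "inner_on d1 d2 x y = inner_on d1 d2 y x"
  by (simp add: inner_on_def mult.commute)

lemma inner_on_add: "inner_on d1 d2 z (\<lambda>p. x p + y p) = inner_on d1 d2 z x + inner_on d1 d2 z y"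
  by (simp add: inner_on_def distrib_left sum.distrib)

lemma inner_on_diff: "inner_on d1 d2 z (\<lambda>p. x p - y p) = inner_on d1 d2 z x - inner_on d1 d2 z y"
  by (simp add: inner_on_def right_diff_distrib sum_subtractf)

lemma gram_error_commute: "gram_error d1 d2 n A x y = gram_error d1 d2 n A y x"
  by (simp add: gram_error_def inner_on_commute[of d1 d2 x] mult.commute)

lemma response_eq: "response d1 d2 \<sigma> x t \<omega> k = inner_on d1 d2 (fst \<omega> k) x + t / \<sigma> * snd \<omega> k"
  by (simp add: response_def inner_on_def mult.commute)

lemma energy_eq: "energy d1 d2 x t = inner_on d1 d2 x x + t\<^sup>2"
  by (simp add: energy_def inner_on_def power2_eq_square)

lemma gram_error_polarization:
  "4 * gram_error d1 d2 n (fst \<omega>) x y =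
    deviation d1 d2 n \<sigma> (\<lambda>p. x p + y p) 0 \<omega> - deviation d1 d2 n \<sigma> (\<lambda>p. x p - y p) 0 \<omega>"
proof -
  have add_left: "inner_on d1 d2 (\<lambda>p. x p + y p) z = inner_on d1 d2 x z + inner_on d1 d2 y z"
    and diff_left: "inner_on d1 d2 (\<lambda>p. x p - y p) z = inner_on d1 d2 x z - inner_on d1 d2 y z" for z
    by (simp_all add: inner_on_commute[of d1 d2 _ z] inner_on_add inner_on_diff)
  show ?thesis
    by (simp add: gram_error_def deviation_def response_eq energy_eq inner_on_add inner_on_diff
        add_left diff_left inner_on_commute[of d1 d2 y x] power2_eq_square
        algebra_simps sum.distrib sum_subtractf sum_distrib_left)
qed

lemma noise_polarization:
  assumes "\<sigma> \<noteq> 0"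
  shows "4 * (\<Sum>k<n. snd \<omega> k * inner_on d1 d2 (fst \<omega> k) x) =
    \<sigma> * (deviation d1 d2 n \<sigma> x 1 \<omega> - deviation d1 d2 n \<sigma> x (- 1) \<omega>)"
proof -
  have "(response d1 d2 \<sigma> x 1 \<omega> k)\<^sup>2 - (response d1 d2 \<sigma> x (- 1) \<omega> k)\<^sup>2 =
      4 / \<sigma> * (snd \<omega> k * inner_on d1 d2 (fst \<omega> k) x)" for k
    by (simp add: response_eq power2_eq_square algebra_simps)
  then have "deviation d1 d2 n \<sigma> x 1 \<omega> - deviation d1 d2 n \<sigma> x (- 1) \<omega> =
      4 / \<sigma> * (\<Sum>k<n. snd \<omega> k * inner_on d1 d2 (fst \<omega> k) x)"
    by (simp add: deviation_def energy_eq sum_subtractf[symmetric] sum_distrib_left)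
  then show ?thesis using assms by simp
qed

lemma gram_error_eq_sum:
  "gram_error d1 d2 n A x y =
    (\<Sum>p\<in>{..<d1} \<times> {..<d2}. ((\<Sum>k<n. inner_on d1 d2 (A k) x * A k p) - real n * x p) * y p)"
proof -
  have "(\<Sum>k<n. inner_on d1 d2 (A k) x * inner_on d1 d2 (A k) y) =
      (\<Sum>p\<in>{..<d1} \<times> {..<d2}. \<Sum>k<n. inner_on d1 d2 (A k) x * (A k p * y p))"
    unfolding inner_on_def[of d1 d2 _ y] sum_distrib_left by (rule sum.swap)
  then show ?thesis
    by (simp add: gram_error_def inner_on_def[of d1 d2 x y] left_diff_distrib sum_subtractf
        sum_distrib_left sum_distrib_right mult.assoc)
qed

lemma noise_eq_sum:
  "(\<Sum>k<n. \<eta> k * inner_on d1 d2 (A k) x) = (\<Sum>p\<in>{..<d1} \<times> {..<d2}. (\<Sum>k<n. \<eta> k * A k p) * x p)"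
proof -
  have "(\<Sum>k<n. \<eta> k * inner_on d1 d2 (A k) x) = (\<Sum>p\<in>{..<d1} \<times> {..<d2}. \<Sum>k<n. \<eta> k * (A k p * x p))"
    unfolding inner_on_def sum_distrib_left by (rule sum.swap)
  then show ?thesis by (simp add: sum_distrib_right mult.assoc)
qed

lemma finite_family_event:
  assumes \<sigma>: "0 < \<sigma>" and \<delta>: "0 \<le> \<delta>" and Z: "finite Z"
    and small: "real (card Z) * (2 * exp (- (real n * min 1 \<delta> * \<delta> / 16))) \<le> \<epsilon>"
  shows "\<exists>E\<in>sets (data_law d1 d2 n \<sigma>). measure (data_law d1 d2 n \<sigma>) E \<ge> 1 - \<epsilon> \<and>
    (\<forall>\<omega>\<in>E. \<forall>(x, t)\<in>Z. \<bar>deviation d1 d2 n \<sigma> x t \<omega>\<bar> \<le> real n * \<delta> * energy d1 d2 x t)"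
proof -
  let ?M = "data_law d1 d2 n \<sigma>"
  interpret prob_space ?M by (rule prob_space_data_law[OF \<sigma>])
  define bad where "bad = (\<lambda>z. {\<omega> \<in> space ?M.
    real n * \<delta> * energy d1 d2 (fst z) (snd z) < \<bar>deviation d1 d2 n \<sigma> (fst z) (snd z) \<omega>\<bar>})"
  have bad: "bad z \<in> sets ?M" for z unfolding bad_def by measurable
  have "measure ?M (\<Union>z\<in>Z. bad z) \<le> (\<Sum>z\<in>Z. measure ?M (bad z))"
    using Z bad by (intro finite_measure_subadditive_finite) auto
  also have "\<dots> \<le> (\<Sum>z\<in>Z. 2 * exp (- (real n * min 1 \<delta> * \<delta> / 16)))"
    unfolding bad_def by (intro sum_mono deviation_tail \<sigma> \<delta>)
  also have "\<dots> \<le> \<epsilon>" using small by simp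
  finally have "measure ?M (\<Union>z\<in>Z. bad z) \<le> \<epsilon>" .
  moreover have U: "(\<Union>z\<in>Z. bad z) \<in> sets ?M" using Z bad by blast
  ultimately have "1 - \<epsilon> \<le> measure ?M (space ?M - (\<Union>z\<in>Z. bad z))"
    by (simp add: prob_compl)
  moreover have "\<bar>deviation d1 d2 n \<sigma> x t \<omega>\<bar> \<le> real n * \<delta> * energy d1 d2 x t"
    if "\<omega> \<in> space ?M - (\<Union>z\<in>Z. bad z)" "(x, t) \<in> Z" for \<omega> x t
  proof -
    have "\<omega> \<notin> bad (x, t)" "\<omega> \<in> space ?M" using that by blast+
    then show ?thesis unfolding bad_def by simp
  qed
  ultimately show ?thesis
    using U by (intro bexI[of _ "space ?M - (\<Union>z\<in>Z. bad z)"]) auto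
qed

text \<open>
  The arguments at which polarization evaluates the deviation: \<open>x \<plusminus> y\<close> for the gram error, and \<open>x\<close>
  with noise coefficient \<open>\<plusminus> 1\<close> for the noise term.
\<close>
definition polarization_set ::
    "(nat \<times> nat \<Rightarrow> real) set \<Rightarrow> ((nat \<times> nat \<Rightarrow> real) \<times> real) set" where
  "polarization_set N = (\<lambda>(x, y). (\<lambda>p. x p + y p, 0)) ` (N \<times> N) \<union>
    (\<lambda>(x, y). (\<lambda>p. x p - y p, 0)) ` (N \<times> N) \<union> (\<lambda>x. (x, 1)) ` N \<union> (\<lambda>x. (x, - 1)) ` N"

lemma card_polarization_set:
  assumes "finite N" "card N \<le> b"
  shows "finite (polarization_set N)" "card (polarization_set N) \<le> 4 * b\<^sup>2"
proof -
  show "finite (polarization_set N)" using assms by (simp add: polarization_set_def)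
  have "card (polarization_set N) \<le> card (N \<times> N) + card (N \<times> N) + card N + card N"
    unfolding polarization_set_def
    by (intro order_trans[OF card_Un_le] add_mono card_image_le) (use assms in auto)
  also have "\<dots> \<le> b\<^sup>2 + b\<^sup>2 + b\<^sup>2 + b\<^sup>2"
  proof (intro add_mono)
    show "card (N \<times> N) \<le> b\<^sup>2"
      using assms(2) by (simp add: card_cartesian_product power2_eq_square mult_mono)
    then show "card (N \<times> N) \<le> b\<^sup>2" .
    have "b \<le> b\<^sup>2" by (simp add: power2_eq_square)
    then show "card N \<le> b\<^sup>2" using assms(2) by simp
    then show "card N \<le> b\<^sup>2" .
  qed
  finally show "card (polarization_set N) \<le> 4 * b\<^sup>2" by simp
qed

text \<open>
  The gram error is bilinear, so the passage from the norming set to arbitrary sums is made for one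
  argument at a time, and the factor \<open>4\<close> occurs twice.
\<close>
lemma net_to_factored_sums:
  assumes \<sigma>: "0 < \<sigma>" and \<delta>: "0 \<le> \<delta>"
    and N: "norming_set d1 d2 r N"
    and dev: "\<And>x t. (x, t) \<in> polarization_set N \<Longrightarrow>
      \<bar>deviation d1 d2 n \<sigma> x t \<omega>\<bar> \<le> real n * \<delta> * energy d1 d2 x t"
    and x: "factored_sum d1 d2 r a x" and y: "factored_sum d1 d2 r b y" and "0 \<le> a"
  shows "\<bar>gram_error d1 d2 n (fst \<omega>) x y\<bar> \<le> 16 * real n * \<delta> * a * b"
    and "\<bar>\<Sum>k<n. snd \<omega> k * inner_on d1 d2 (fst \<omega> k) x\<bar> \<le> 4 * real n * \<delta> * \<sigma> * a"
proof -
  define c where "c = real n * \<delta>"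
  have c: "0 \<le> c" using \<delta> by (simp add: c_def)
  have norm: "inner_on d1 d2 x x \<le> 1" if "x \<in> N" for x
    using N that by (simp add: norming_set_def L2_set_def inner_on_def power2_eq_square)
  have dev_le: "\<bar>deviation d1 d2 n \<sigma> x t \<omega>\<bar> \<le> c * energy d1 d2 x t"
    if "(x, t) \<in> polarization_set N" for x t
    using dev[OF that] by (simp add: c_def)
  have net_pair: "\<bar>gram_error d1 d2 n (fst \<omega>) x y\<bar> \<le> c" if xy: "x \<in> N" "y \<in> N" for x y
  proof -
    have "4 * \<bar>gram_error d1 d2 n (fst \<omega>) x y\<bar> \<le>
        \<bar>deviation d1 d2 n \<sigma> (\<lambda>p. x p + y p) 0 \<omega>\<bar> + \<bar>deviation d1 d2 n \<sigma> (\<lambda>p. x p - y p) 0 \<omega>\<bar>"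
      using gram_error_polarization[of d1 d2 n \<omega> x y \<sigma>] by linarith
    also have "\<dots> \<le> c * energy d1 d2 (\<lambda>p. x p + y p) 0 + c * energy d1 d2 (\<lambda>p. x p - y p) 0"
      using xy by (intro add_mono dev_le) (auto simp: polarization_set_def)
    also have "\<dots> = c * (2 * inner_on d1 d2 x x + 2 * inner_on d1 d2 y y)"
    proof -
      have "energy d1 d2 (\<lambda>p. x p + y p) 0 + energy d1 d2 (\<lambda>p. x p - y p) 0 =
          2 * inner_on d1 d2 x x + 2 * inner_on d1 d2 y y"
        unfolding energy_def inner_on_def sum_distrib_left
        by (simp add: sum.distrib[symmetric] power2_eq_square algebra_simps)
      then show ?thesis by (simp only: distrib_left[symmetric])
    qed
    also have "\<dots> \<le> c * 4"
      using norm[OF xy(1)] norm[OF xy(2)] c by (intro mult_left_mono) auto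
    finally show ?thesis by simp
  qed
  have net_noise: "\<bar>\<Sum>k<n. snd \<omega> k * inner_on d1 d2 (fst \<omega> k) x\<bar> \<le> c * \<sigma>" if x: "x \<in> N" for x
  proof -
    have "4 * \<bar>\<Sum>k<n. snd \<omega> k * inner_on d1 d2 (fst \<omega> k) x\<bar> =
        \<sigma> * \<bar>deviation d1 d2 n \<sigma> x 1 \<omega> - deviation d1 d2 n \<sigma> x (- 1) \<omega>\<bar>"
      using arg_cong[OF noise_polarization[where \<sigma> = \<sigma> and \<omega> = \<omega> and x = x], of abs] \<sigma> by (simp add: abs_mult)
    also have "\<dots> \<le> \<sigma> * (c * energy d1 d2 x 1 + c * energy d1 d2 x (- 1))"
      using dev_le[of x 1] dev_le[of x "- 1"] x \<sigma>
      by (intro mult_left_mono) (auto simp: polarization_set_def)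
    also have "\<dots> = \<sigma> * (c * (2 * (inner_on d1 d2 x x + 1)))"
      by (simp add: energy_eq algebra_simps)
    also have "\<dots> \<le> \<sigma> * (c * (2 * 2))"
      using norm[OF x] c \<sigma> by (intro mult_left_mono) auto
    finally show ?thesis by (simp add: mult.commute)
  qed
  \<comment> \<open>The first argument ranges over the norming set, the second is already arbitrary.\<close>
  have half: "\<bar>gram_error d1 d2 n (fst \<omega>) z x\<bar> \<le> 4 * c * a" if "z \<in> N" for z
    unfolding gram_error_eq_sum
  proof (rule factored_sum_form_bound[OF x])
    show "0 \<le> 4 * c" using c by simp
    show "\<bar>\<Sum>q\<in>{..<d1} \<times> {..<d2}.
        ((\<Sum>k<n. inner_on d1 d2 (fst \<omega> k) z * fst \<omega> k q) - real n * z q) * factored r W V q\<bar>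
      \<le> 4 * c * L2_set W ({..<d1} \<times> {..<r}) * operator_norm d2 r V" for W V
      using net_pair[OF that] unfolding gram_error_eq_sum by (rule norming_setD[OF N])
  qed
  then have half': "\<bar>gram_error d1 d2 n (fst \<omega>) x z\<bar> \<le> 4 * c * a" if "z \<in> N" for z
    using that by (subst gram_error_commute)
  have "\<bar>gram_error d1 d2 n (fst \<omega>) x y\<bar> \<le> 4 * (4 * c * a) * b"
    unfolding gram_error_eq_sum
  proof (rule factored_sum_form_bound[OF y])
    show "0 \<le> 4 * (4 * c * a)" using c \<open>0 \<le> a\<close> by simp
    show "\<bar>\<Sum>q\<in>{..<d1} \<times> {..<d2}.
        ((\<Sum>k<n. inner_on d1 d2 (fst \<omega> k) x * fst \<omega> k q) - real n * x q) * factored r W V q\<bar>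
      \<le> 4 * (4 * c * a) * L2_set W ({..<d1} \<times> {..<r}) * operator_norm d2 r V" for W V
      using half' unfolding gram_error_eq_sum by (rule norming_setD[OF N])
  qed
  then show "\<bar>gram_error d1 d2 n (fst \<omega>) x y\<bar> \<le> 16 * real n * \<delta> * a * b"
    by (simp add: c_def mult.assoc)
  have "\<bar>\<Sum>k<n. snd \<omega> k * inner_on d1 d2 (fst \<omega> k) x\<bar> \<le> 4 * (c * \<sigma>) * a"
    unfolding noise_eq_sum
  proof (rule factored_sum_form_bound[OF x])
    show "0 \<le> 4 * (c * \<sigma>)" using c \<sigma> by simp
    show "\<bar>\<Sum>q\<in>{..<d1} \<times> {..<d2}. (\<Sum>k<n. snd \<omega> k * fst \<omega> k q) * factored r W V q\<bar>
      \<le> 4 * (c * \<sigma>) * L2_set W ({..<d1} \<times> {..<r}) * operator_norm d2 r V" for W V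
      using net_noise unfolding noise_eq_sum by (rule norming_setD[OF N])
  qed
  then show "\<bar>\<Sum>k<n. snd \<omega> k * inner_on d1 d2 (fst \<omega> k) x\<bar> \<le> 4 * real n * \<delta> * \<sigma> * a"
    by (simp add: c_def mult.assoc)
qed

text \<open>
  The left-hand side is the union bound for \<open>4 (7 ^ m)\<^sup>2\<close> events; it follows from \<open>49 \<le> 2 ^ 6\<close>,
  \<open>8 \<le> exp m\<close>, \<open>D \<le> exp m\<close> and \<open>2 \<le> exp 1\<close>.
\<close>
lemma net_size_beats_tail:
  fixes m :: nat
  assumes "3 \<le> m" "0 < D" "D \<le> real m" "8 * real m \<le> e"
  shows "real (4 * (7 ^ m)\<^sup>2) * (2 * exp (- e)) \<le> 1 / D"
proof -
  have two: "2 ^ k \<le> exp (real k)" for k :: nat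
    using power_mono[of 2 "exp (1 :: real)" k] exp_ge_add_one_self[of "1 :: real"]
    by (simp add: exp_of_nat_mult[symmetric])
  have "(7 ^ m)\<^sup>2 = (49 :: real) ^ m" by (simp add: power2_eq_square power_mult_distrib[symmetric])
  also have "\<dots> \<le> (2 ^ 6) ^ m" by (rule power_mono) auto
  also have "\<dots> = 2 ^ (6 * m)" by (simp add: power_mult)
  also have "\<dots> \<le> exp (real (6 * m))" by (rule two)
  finally have "(7 ^ m)\<^sup>2 \<le> exp (6 * real m)" by simp
  moreover have "(8 :: real) \<le> exp (real m)"
    using two[of 3] assms(1) order_trans[of "exp 3" "exp (real m)"] by (auto intro: order_trans)
  moreover have "D \<le> exp (real m)"
    using exp_ge_add_one_self[of "real m"] assms by linarith
  ultimately have "8 * (7 ^ m)\<^sup>2 * D \<le> exp (real m) * exp (6 * real m) * exp (real m)"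
    using assms by (intro mult_mono) auto
  also have "\<dots> = exp (8 * real m)" by (simp add: exp_add[symmetric])
  also have "\<dots> \<le> exp e" using assms by simp
  finally show ?thesis using assms by (simp add: exp_minus field_simps)
qed

text \<open>
  With \<open>\<rho> = r (d1 + d2) / n\<close>, the exponent in \<open>deviation_tail\<close> has to be of order \<open>n \<rho>\<close>. For
  \<open>\<delta> \<le> 1\<close> this holds as \<open>\<delta>\<^sup>2\<close> is proportional to \<open>\<rho>\<close>; for \<open>\<delta> > 1\<close> the exponent is only linear in
  \<open>\<delta>\<close>, and \<open>\<rho> \<le> 16\<close> gives \<open>\<surd>\<rho> \<ge> \<rho> / 4\<close>.
\<close>
lemma uniform_deviation_event:
  fixes d1 d2 n r :: nat and \<sigma> :: real
  assumes \<sigma>: "0 < \<sigma>" and n: "0 < n" and r: "0 < r" and D: "3 \<le> d1 + d2"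
    and \<rho>: "real r * real (d1 + d2) / real n \<le> 16"
  defines "\<delta> \<equiv> 512 * sqrt (real r * real (d1 + d2) / real n)"
  shows "\<exists>E\<in>sets (data_law d1 d2 n \<sigma>). measure (data_law d1 d2 n \<sigma>) E \<ge> 1 - 1 / real (d1 + d2) \<and>
    (\<forall>\<omega>\<in>E. \<forall>x a. factored_sum d1 d2 r a x \<longrightarrow> 0 \<le> a \<longrightarrow>
      \<bar>gram_error d1 d2 n (fst \<omega>) x x\<bar> \<le> 16 * real n * \<delta> * a * a \<and>
      \<bar>\<Sum>k<n. snd \<omega> k * inner_on d1 d2 (fst \<omega> k) x\<bar> \<le> 4 * real n * \<delta> * \<sigma> * a)"
proof -
  define m where "m = r * (d1 + d2)"
  define \<rho>' where "\<rho>' = real r * real (d1 + d2) / real n"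
  have m: "real m = real n * \<rho>'" using n by (simp add: m_def \<rho>'_def)
  have \<rho>': "0 < \<rho>'" "\<rho>' \<le> 16" using n r D \<rho> by (simp_all add: \<rho>'_def)
  have \<delta>: "0 \<le> \<delta>" "\<delta> = 512 * sqrt \<rho>'" by (simp_all add: \<delta>_def \<rho>'_def)
  obtain N where N: "finite N" "card N \<le> 7 ^ m"
    "norming_set d1 d2 r N"
    using exists_norming_set[of r d1 d2] unfolding m_def by blast
  have "real (card (polarization_set N)) * (2 * exp (- (real n * min 1 \<delta> * \<delta> / 16))) \<le>
      real (4 * (7 ^ m)\<^sup>2) * (2 * exp (- (real n * min 1 \<delta> * \<delta> / 16)))"
    using card_polarization_set(2)[OF N(1,2)] by (intro mult_right_mono) (auto simp del: of_nat_mult)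
  also have "\<dots> \<le> 1 / real (d1 + d2)"
  proof (rule net_size_beats_tail)
    have "1 * (d1 + d2) \<le> m" unfolding m_def using r by (intro mult_right_mono) auto
    then show "3 \<le> m" and "real (d1 + d2) \<le> real m"
      using D by auto
    show "0 < real (d1 + d2)" using D by simp
    have "\<rho>' \<le> 4 * sqrt \<rho>'"
    proof -
      have "sqrt \<rho>' \<le> 4" using real_sqrt_le_mono[OF \<rho>'(2)] by simp
      then have "sqrt \<rho>' * sqrt \<rho>' \<le> 4 * sqrt \<rho>'" using \<rho>' by (intro mult_right_mono) auto
      then show ?thesis using \<rho>' by simp
    qed
    then have "128 * \<rho>' \<le> \<delta>" by (simp add: \<delta>(2))
    moreover have "\<delta> * \<delta> = 512 * 512 * \<rho>'" using \<rho>' by (simp add: \<delta>(2))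
    ultimately have "128 * \<rho>' \<le> min 1 \<delta> * \<delta>" using \<rho>' by (simp add: min_def)
    then have "real n * (128 * \<rho>') \<le> real n * (min 1 \<delta> * \<delta>)" by (intro mult_left_mono) auto
    then show "8 * real m \<le> real n * min 1 \<delta> * \<delta> / 16" by (simp add: m)
  qed
  finally have small: "real (card (polarization_set N)) *
      (2 * exp (- (real n * min 1 \<delta> * \<delta> / 16))) \<le> 1 / real (d1 + d2)" .
  from finite_family_event[OF \<sigma> \<delta>(1) card_polarization_set(1)[OF N(1,2)] small, of d1 d2]
  obtain E where E: "E \<in> sets (data_law d1 d2 n \<sigma>)"
    "measure (data_law d1 d2 n \<sigma>) E \<ge> 1 - 1 / real (d1 + d2)"
    "\<And>\<omega> x t. \<omega> \<in> E \<Longrightarrow> (x, t) \<in> polarization_set N \<Longrightarrow>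
      \<bar>deviation d1 d2 n \<sigma> x t \<omega>\<bar> \<le> real n * \<delta> * energy d1 d2 x t"
    by blast
  show ?thesis
  proof (intro bexI[of _ E] conjI ballI allI impI)
    fix \<omega> x a assume "\<omega> \<in> E" "factored_sum d1 d2 r a x" "0 \<le> a"
    then show "\<bar>gram_error d1 d2 n (fst \<omega>) x x\<bar> \<le> 16 * real n * \<delta> * a * a"
      "\<bar>\<Sum>k<n. snd \<omega> k * inner_on d1 d2 (fst \<omega> k) x\<bar> \<le> 4 * real n * \<delta> * \<sigma> * a"
      using net_to_factored_sums[OF \<sigma> \<delta>(1) N(3) E(3)] by blast+
  qed (use E in auto)
qed

section \<open>Error of the estimate\<close>

lemma mat_trace_sensing:
  assumes "M \<in> carrier_mat d1 d2"
  shows "mat_trace (transpose_mat (sensing_matrix d1 d2 \<omega> k) * M) = inner_on d1 d2 (fst \<omega> k) (\<lambda>p. M $$ p)"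
proof -
  have "mat_trace (transpose_mat (sensing_matrix d1 d2 \<omega> k) * M) =
      (\<Sum>j<d2. \<Sum>i<d1. fst \<omega> k (i, j) * M $$ (i, j))"
    using assms by (simp add: mat_trace_def sensing_matrix_def scalar_prod_def atLeast0LessThan)
  also have "\<dots> = inner_on d1 d2 (fst \<omega> k) (\<lambda>p. M $$ p)"
    unfolding inner_on_def sum_Times by (rule sum.swap)
  finally show ?thesis .
qed

text \<open>
  The loss of \<open>M0\<close> is the sum of the \<open>\<eta>\<^sub>k\<^sup>2\<close>; expanding the squares in the loss of \<open>\<Phi>\<close>, this sum
  cancels.
\<close>
lemma basic_inequality:
  assumes "is_estimate d1 d2 n r \<alpha> (sensing_matrix d1 d2 \<omega>) (observation d1 d2 M0 \<omega>) \<Phi>"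
    and M0: "feasible d1 d2 r \<alpha> M0"
    and h: "\<And>i j. i < d1 \<Longrightarrow> j < d2 \<Longrightarrow> \<Phi> $$ (i, j) - M0 $$ (i, j) = h (i, j)"
  shows "(\<Sum>k<n. (inner_on d1 d2 (fst \<omega> k) h)\<^sup>2) \<le>
    2 * (\<Sum>k<n. snd \<omega> k * inner_on d1 d2 (fst \<omega> k) h)"
proof -
  define loss where "loss = square_loss n (sensing_matrix d1 d2 \<omega>) (observation d1 d2 M0 \<omega>)"
  have "feasible d1 d2 r \<alpha> \<Phi>" "loss \<Phi> \<le> loss M0"
    using assms(1) M0 by (auto simp: is_estimate_def is_arg_min_def loss_def not_less)
  have carrier: "M0 \<in> carrier_mat d1 d2" "\<Phi> \<in> carrier_mat d1 d2"
    using M0 \<open>feasible d1 d2 r \<alpha> \<Phi>\<close> by (simp_all add: feasible_def)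
  have "inner_on d1 d2 (fst \<omega> k) (\<lambda>p. \<Phi> $$ p) =
      inner_on d1 d2 (fst \<omega> k) (\<lambda>p. M0 $$ p) + inner_on d1 d2 (fst \<omega> k) h" for k
    unfolding inner_on_add[symmetric] unfolding inner_on_def
    by (intro sum.cong) (auto simp: h[symmetric])
  then have "loss \<Phi> = (\<Sum>k<n. (snd \<omega> k - inner_on d1 d2 (fst \<omega> k) h)\<^sup>2)"
    using carrier by (simp add: loss_def square_loss_def observation_def mat_trace_sensing)
  moreover have "loss M0 = (\<Sum>k<n. (snd \<omega> k)\<^sup>2)"
    using carrier by (simp add: loss_def square_loss_def observation_def mat_trace_sensing)
  ultimately show ?thesis
    using \<open>loss \<Phi> \<le> loss M0\<close>
    by (simp add: power2_diff sum.distrib sum_subtractf sum_distrib_left mult.assoc)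
qed

lemma estimation_error_bound:
  assumes \<sigma>: "0 < \<sigma>" and \<alpha>: "0 < \<alpha>" and r: "0 < r" and n: "0 < n" and \<delta>: "0 \<le> \<delta>"
    and gram: "\<And>x a. factored_sum d1 d2 r a x \<Longrightarrow> 0 \<le> a \<Longrightarrow>
      \<bar>gram_error d1 d2 n (fst \<omega>) x x\<bar> \<le> 16 * real n * \<delta> * a * a"
    and noise: "\<And>x a. factored_sum d1 d2 r a x \<Longrightarrow> 0 \<le> a \<Longrightarrow>
      \<bar>\<Sum>k<n. snd \<omega> k * inner_on d1 d2 (fst \<omega> k) x\<bar> \<le> 4 * real n * \<delta> * \<sigma> * a"
    and M0: "feasible d1 d2 r \<alpha> M0"
    and \<Phi>: "is_estimate d1 d2 n r \<alpha> (sensing_matrix d1 d2 \<omega>) (observation d1 d2 M0 \<omega>) \<Phi>"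
  shows "(frobenius_norm (\<Phi> - M0))\<^sup>2 \<le> \<delta> * (576 * \<alpha>\<^sup>2 + 48 * \<sigma> * \<alpha>)"
proof -
  have feas: "feasible d1 d2 r \<alpha> \<Phi>" using \<Phi> by (simp add: is_estimate_def is_arg_min_def)
  have atomic: "\<exists>x. factored_sum d1 d2 r (3 * \<alpha>) x \<and> (\<forall>i<d1. \<forall>j<d2. M $$ (i, j) = x (i, j))"
    if "feasible d1 d2 r \<alpha> M" for M
    using that r \<alpha> by (intro factored_sum_of_norm_bounds) (auto simp: feasible_def field_simps)
  obtain x where x: "factored_sum d1 d2 r (3 * \<alpha>) x"
    "\<And>i j. i < d1 \<Longrightarrow> j < d2 \<Longrightarrow> \<Phi> $$ (i, j) = x (i, j)"
    using atomic[OF feas] by blast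
  obtain x0 where x0: "factored_sum d1 d2 r (3 * \<alpha>) x0"
    "\<And>i j. i < d1 \<Longrightarrow> j < d2 \<Longrightarrow> M0 $$ (i, j) = x0 (i, j)"
    using atomic[OF M0] by blast
  define h where "h = (\<lambda>q. x q + - x0 q)"
  have h: "factored_sum d1 d2 r (6 * \<alpha>) h"
    using factored_sum.add[OF x(1) factored_sum_uminus[OF x0(1)]] by (simp add: h_def)
  have entries: "\<Phi> $$ (i, j) - M0 $$ (i, j) = h (i, j)" if "i < d1" "j < d2" for i j
    using x(2)[OF that] x0(2)[OF that] by (simp add: h_def)
  have carrier: "M0 \<in> carrier_mat d1 d2" "\<Phi> \<in> carrier_mat d1 d2"
    using M0 feas by (simp_all add: feasible_def)
  have "(frobenius_norm (\<Phi> - M0))\<^sup>2 = (\<Sum>i<d1. \<Sum>j<d2. (h (i, j))\<^sup>2)"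
    using carrier by (simp add: frobenius_norm_def sum_nonneg entries)
  also have "\<dots> = inner_on d1 d2 h h"
    by (simp add: inner_on_def sum_Times power2_eq_square)
  finally have frob: "(frobenius_norm (\<Phi> - M0))\<^sup>2 = inner_on d1 d2 h h" .
  have "real n * inner_on d1 d2 h h =
      (\<Sum>k<n. (inner_on d1 d2 (fst \<omega> k) h)\<^sup>2) - gram_error d1 d2 n (fst \<omega>) h h"
    by (simp add: gram_error_def power2_eq_square)
  also have "\<dots> \<le> 2 * (\<Sum>k<n. snd \<omega> k * inner_on d1 d2 (fst \<omega> k) h) - gram_error d1 d2 n (fst \<omega>) h h"
    using basic_inequality[OF \<Phi> M0 entries] by simp
  also have "\<dots> \<le> 2 * (4 * real n * \<delta> * \<sigma> * (6 * \<alpha>)) + 16 * real n * \<delta> * (6 * \<alpha>) * (6 * \<alpha>)"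
    using gram[OF h] noise[OF h] \<alpha> by (simp add: abs_le_iff)
  also have "\<dots> = real n * (\<delta> * (576 * \<alpha>\<^sup>2 + 48 * \<sigma> * \<alpha>))"
    by (simp add: power2_eq_square algebra_simps)
  finally show ?thesis using n by (simp add: frob)
qed

theorem mainTheorem12:
  shows "\<exists>C::real. C > 0 \<and>
    (\<forall>(d1::nat) (d2::nat) (n::nat) (r::nat) (\<alpha>::real) (\<sigma>::real).
      d1 > 0 \<longrightarrow> d2 > 0 \<longrightarrow> d1 * d2 \<ge> 2 \<longrightarrow> n > 0 \<longrightarrow> r > 0 \<longrightarrow> \<alpha> > 0 \<longrightarrow> \<sigma> > 0 \<longrightarrow>
      real n \<ge> real r * real (d1 + d2) * ln (real (d1 * d2)) ^ 6 \<longrightarrow>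
      (\<exists>E \<in> sets (data_law d1 d2 n \<sigma>).
        measure (data_law d1 d2 n \<sigma>) E \<ge> 1 - 1 / real (d1 + d2) \<and>
        (\<forall>\<omega>\<in>E. \<forall>M0 \<in> carrier_mat d1 d2.
          frobenius_norm M0 \<le> \<alpha> \<longrightarrow> nuclear_norm M0 \<le> sqrt (real r) * \<alpha> \<longrightarrow>
          (\<forall>\<Phi>. is_estimate d1 d2 n r \<alpha> (sensing_matrix d1 d2 \<omega>) (observation d1 d2 M0 \<omega>) \<Phi> \<longrightarrow>
            (frobenius_norm (\<Phi> - M0))\<^sup>2 \<le>
              C * \<alpha>\<^sup>2 * max 1 (\<sigma> * sqrt (ln (real (d1 + d2))) / \<alpha>) *
              sqrt (real r * real (d1 + d2) * ln (real (d1 * d2)) ^ 6 / real n)))))"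
  \<comment> \<open>\<open>624 = 576 + 48\<close> from the error bound, \<open>512\<close> from \<open>\<delta>\<close>, and \<open>4 \<ge> 1 / (2 / 3) ^ 3\<close> for the logarithm.\<close>
proof (rule exI[of _ "624 * 512 * 4 :: real"], intro conjI allI impI)
  show "(0 :: real) < 624 * 512 * 4" by simp
  fix d1 d2 n r :: nat and \<alpha> \<sigma> :: real
  assume d: "0 < d1" "0 < d2" "2 \<le> d1 * d2" and n: "0 < n" and r: "0 < r"
    and \<alpha>: "0 < \<alpha>" and \<sigma>: "0 < \<sigma>"
    and samples: "real r * real (d1 + d2) * ln (real (d1 * d2)) ^ 6 \<le> real n"
  define L where "L = ln (real (d1 * d2))"
  define \<rho> where "\<rho> = real r * real (d1 + d2) / real n"
  define \<delta> where "\<delta> = 512 * sqrt \<rho>"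
  define \<mu> where "\<mu> = max 1 (\<sigma> * sqrt (ln (real (d1 + d2))) / \<alpha>)"
  have D: "3 \<le> d1 + d2"
  proof (rule ccontr)
    assume "\<not> ?thesis"
    then have "d1 = 1" "d2 = 1" using d(1,2) by linarith+
    then show False using d(3) by simp
  qed
  have "2 \<le> real (d1 * d2)" using d(3) by (metis of_nat_le_iff of_nat_numeral)
  then have "ln 2 \<le> L" unfolding L_def by (subst ln_le_cancel_iff) linarith+
  then have L: "2 / 3 \<le> L" using ln2_ge_two_thirds by linarith
  have \<rho>: "0 \<le> \<rho>" by (simp add: \<rho>_def)
  have "(2 / 3) ^ 6 * \<rho> \<le> L ^ 6 * \<rho>"
    using L \<rho> by (intro mult_right_mono power_mono) auto
  also have "\<dots> \<le> 1" using samples n by (simp add: \<rho>_def L_def field_simps)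
  finally have "\<rho> \<le> 16" by (simp add: power_divide)
  from uniform_deviation_event[OF \<sigma> n r D this[unfolded \<rho>_def], folded \<rho>_def, folded \<delta>_def]
  obtain E where E: "E \<in> sets (data_law d1 d2 n \<sigma>)"
    "measure (data_law d1 d2 n \<sigma>) E \<ge> 1 - 1 / real (d1 + d2)"
    "\<And>\<omega> x a. \<omega> \<in> E \<Longrightarrow> factored_sum d1 d2 r a x \<Longrightarrow> 0 \<le> a \<Longrightarrow>
      \<bar>gram_error d1 d2 n (fst \<omega>) x x\<bar> \<le> 16 * real n * \<delta> * a * a"
    "\<And>\<omega> x a. \<omega> \<in> E \<Longrightarrow> factored_sum d1 d2 r a x \<Longrightarrow> 0 \<le> a \<Longrightarrow>
      \<bar>\<Sum>k<n. snd \<omega> k * inner_on d1 d2 (fst \<omega> k) x\<bar> \<le> 4 * real n * \<delta> * \<sigma> * a"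
    by blast
  have rate: "\<delta> * (576 * \<alpha>\<^sup>2 + 48 * \<sigma> * \<alpha>) \<le> 624 * 512 * 4 * \<alpha>\<^sup>2 * \<mu> * sqrt (\<rho> * L ^ 6)"
  proof -
    have "1 \<le> ln (real (d1 + d2))"
    proof -
      have "exp 1 \<le> real (d1 + d2)" using exp_le D by linarith
      then show ?thesis using ln_ge_iff[of "real (d1 + d2)" 1] D by simp
    qed
    then have "\<sigma> * 1 \<le> \<sigma> * sqrt (ln (real (d1 + d2)))"
      using \<sigma> by (intro mult_left_mono) auto
    then have "\<sigma> / \<alpha> \<le> \<mu>"
      using \<alpha> divide_right_mono[of "\<sigma> * 1" "\<sigma> * sqrt (ln (real (d1 + d2)))" \<alpha>] by (simp add: \<mu>_def)
    then have "\<alpha>\<^sup>2 * (\<sigma> / \<alpha>) \<le> \<alpha>\<^sup>2 * \<mu>"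
      by (intro mult_left_mono) auto
    moreover have "\<sigma> * \<alpha> = \<alpha>\<^sup>2 * (\<sigma> / \<alpha>)"
      using \<alpha> by (simp add: power2_eq_square)
    ultimately have "\<sigma> * \<alpha> \<le> \<alpha>\<^sup>2 * \<mu>" by linarith
    moreover have "\<alpha>\<^sup>2 * 1 \<le> \<alpha>\<^sup>2 * \<mu>"
      by (intro mult_left_mono) (auto simp: \<mu>_def)
    ultimately have level: "576 * \<alpha>\<^sup>2 + 48 * \<sigma> * \<alpha> \<le> 624 * (\<alpha>\<^sup>2 * \<mu>)" by linarith
    have "sqrt (\<rho> * L ^ 6) = sqrt \<rho> * L ^ 3"
    proof -
      have "sqrt (L ^ 6) = sqrt ((L ^ 3)\<^sup>2)" by (simp add: power_mult[symmetric])
      also have "\<dots> = L ^ 3" using L by (subst real_sqrt_abs) simp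
      finally show ?thesis by (simp add: real_sqrt_mult)
    qed
    moreover have "sqrt \<rho> * 1 \<le> sqrt \<rho> * (4 * L ^ 3)"
    proof (intro mult_left_mono)
      have "(2 / 3) ^ 3 \<le> L ^ 3" using L by (intro power_mono) auto
      then show "1 \<le> 4 * L ^ 3" by (simp add: power_divide)
    qed (use \<rho> in simp)
    ultimately have "\<delta> \<le> 512 * 4 * sqrt (\<rho> * L ^ 6)" by (simp add: \<delta>_def)
    then have "\<delta> * (576 * \<alpha>\<^sup>2 + 48 * \<sigma> * \<alpha>) \<le>
        (512 * 4 * sqrt (\<rho> * L ^ 6)) * (624 * (\<alpha>\<^sup>2 * \<mu>))"
      using level \<rho> L \<alpha> \<sigma> by (intro mult_mono) auto
    then show ?thesis by (simp add: mult_ac)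
  qed
  show "\<exists>E \<in> sets (data_law d1 d2 n \<sigma>).
      measure (data_law d1 d2 n \<sigma>) E \<ge> 1 - 1 / real (d1 + d2) \<and>
      (\<forall>\<omega>\<in>E. \<forall>M0 \<in> carrier_mat d1 d2.
        frobenius_norm M0 \<le> \<alpha> \<longrightarrow> nuclear_norm M0 \<le> sqrt (real r) * \<alpha> \<longrightarrow>
        (\<forall>\<Phi>. is_estimate d1 d2 n r \<alpha> (sensing_matrix d1 d2 \<omega>) (observation d1 d2 M0 \<omega>) \<Phi> \<longrightarrow>
          (frobenius_norm (\<Phi> - M0))\<^sup>2 \<le>
            624 * 512 * 4 * \<alpha>\<^sup>2 * max 1 (\<sigma> * sqrt (ln (real (d1 + d2))) / \<alpha>) *
            sqrt (real r * real (d1 + d2) * ln (real (d1 * d2)) ^ 6 / real n)))"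
  proof (intro bexI[of _ E] conjI ballI allI impI)
    fix \<omega> M0 \<Phi>
    assume \<omega>: "\<omega> \<in> E" and M0: "M0 \<in> carrier_mat d1 d2" "frobenius_norm M0 \<le> \<alpha>"
      "nuclear_norm M0 \<le> sqrt (real r) * \<alpha>"
      and \<Phi>: "is_estimate d1 d2 n r \<alpha> (sensing_matrix d1 d2 \<omega>) (observation d1 d2 M0 \<omega>) \<Phi>"
    have "feasible d1 d2 r \<alpha> M0"
      using M0 r by (simp add: feasible_def field_simps)
    then have "(frobenius_norm (\<Phi> - M0))\<^sup>2 \<le> \<delta> * (576 * \<alpha>\<^sup>2 + 48 * \<sigma> * \<alpha>)"
      using \<rho> by (intro estimation_error_bound[OF \<sigma> \<alpha> r n _ E(3)[OF \<omega>] E(4)[OF \<omega>] _ \<Phi>])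
        (simp_all add: \<delta>_def)
    also note rate
    also have "\<rho> * L ^ 6 = real r * real (d1 + d2) * ln (real (d1 * d2)) ^ 6 / real n"
      by (simp add: \<rho>_def L_def)
    finally show "(frobenius_norm (\<Phi> - M0))\<^sup>2 \<le>
        624 * 512 * 4 * \<alpha>\<^sup>2 * max 1 (\<sigma> * sqrt (ln (real (d1 + d2))) / \<alpha>) *
        sqrt (real r * real (d1 + d2) * ln (real (d1 * d2)) ^ 6 / real n)"
      unfolding \<mu>_def .
  qed (use E in auto)
qed

end
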